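(* Consider a circuit in the class RLCM$b$ (described in the context, with all memristor and topological assumptions stated there), so that only $n_\Phi<n_C$ of the capacitors, namely those with indices $1,\dots,n_\Phi$, have a flux-controlled memristor in parallel and there are no other memristors. Let $$H_{\alpha\alpha}=A_{CR}R_{\mathcal L}^{-1}A_{CR}^\top,\quad H_{\alpha\beta}=A_{CL},\quad H_{\beta\beta}=A_{RL}^\top R_{\mathcal T}A_{RL},\quad H=\begin{pmatrix} H_{\alpha\alpha} & H_{\alpha\beta} \\ -H_{\alpha\beta}^\top & H_{\beta\beta} \end{pmatrix}.$$ Suppose that: 1) any active resistor $R_i<0$ is in parallel to a capacitor $C_i$ and also to a flux-controlled memristor (the one with index $i$, $1\le i\le n_\Phi$, distinct active resistors being in parallel to distinct memristors), and $G_{mi}>|1/R_i|$; 2) the combined matrix $(A_{CL},A_{CR})$, which has $n_C$ rows, has rank $n_C$; 3) the symmetric matrix $H_{\beta\beta}$ is positive definite; 4) $\|L^{1/2}H_{\beta\beta}^{-1}H_{\alpha\beta}^\top C^{-1/2}\|_2<1$, where $\|\cdot\|_2$ is the spectral norm. Then, for any $v_{C0}\in\mathbb R^{n_C}$, $i_{L0}\in\mathbb R^{n_L}$, $\Phi_{M0}\in\mathbb R^{n_\Phi}$, any solution $(\varphi_C,q_L)\in\mathbb R^{n_C}\times\mathbb R^{n_L}$ of the state equations in the flux-charge domain $$\begin{pmatrix} C\dot\varphi_C \\ L\dot q_L \end{pmatrix}=-H\begin{pmatrix} \varphi_C \\ q_L \end{pmatrix}-\begin{pmatrix} \hat Q_{MC}(\varphi_{CM}+\Phi_{M0})-\hat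 Q_{MC}(\Phi_{M0}) \\ 0 \\ 0 \end{pmatrix}+\begin{pmatrix} C v_{C0} \\ L i_{L0} \end{pmatrix}$$ (where $\varphi_{CM}=(\varphi_{C1},\dots,\varphi_{Cn_\Phi})$ and the zero blocks have sizes $n_C-n_\Phi$ and $n_L$) is bounded and converges as $t\to+\infty$ to the set $E$ of equilibrium points of this system; moreover, it converges to a single point $(\bar\varphi_C,\bar q_L)\in E$ when the equilibrium points are isolated.
   Context: Circuit. A connected digraph whose branches are: $n_C$ capacitive branches, the first $n_\Phi$ of which consist of a capacitor $C_i>0$ in parallel with a flux-controlled memristor with characteristic $\hat Q_{Mi}:\mathbb R\to\mathbb R$, the others being single capacitors $C_i>0$; $n_L$ inductive branches, each a single inductor $L_i>0$; and linear resistors with resistances $R_i\ne0$, called passive if $R_i>0$ and active if $R_i<0$. Two branches are in parallel if they have the same two end nodes. Topological assumption. There is a spanning tree $\mathcal T$ with co-tree $\mathcal L$ such that all capacitive branches belong to $\mathcal T$ and the other branches of $\mathcal T$ are resistors; all inductive branches belong to $\mathcal L$ and the other branches of $\mathcal L$ are resistors; each resistor in $\mathcal L$ forms a (fundamental) loop exclusively with capacitive branches. Matrices. Kirchhoff's charge law for the fundamental cut-sets reads $q_{\mathcal T}+Aq_{\mathcal L}=0$, where $q_{\mathcal T},q_{\mathcal L}$ are the tree and co-tree branch charges and $A$ has entries in $\{-1,0,1\}$. Partition $A=\begin{pmatrix} A_{CL} & A_{CR} \\ A_{RL} & A_{RR} \end{pmatrix}$, with rows split into capacitive tree branches and tree resistors,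 and columns split into inductive co-tree branches and co-tree resistors (under the topological assumption $A_{RR}=0$). $R_{\mathcal T}$, $R_{\mathcal L}$ are the diagonal matrices of the resistances of the resistors in $\mathcal T$, $\mathcal L$; $C=\mathrm{diag}(C_1,\dots,C_{n_C})$, $L=\mathrm{diag}(L_1,\dots,L_{n_L})$; $\hat Q_{MC}(x)=(\hat Q_{M1}(x_1),\dots,\hat Q_{Mn_\Phi}(x_{n_\Phi}))$. Memristor assumption. For each $i$: $\hat Q_{Mi}\in C^1(\mathbb R)$, $\hat Q_{Mi}(0)=0$, $\hat Q_{Mi}'\ge0$ everywhere, and $G_{mi}>0$, $\tilde\Phi_{Mi}>0$ are constants such that $\hat Q_{Mi}(\Phi)/\Phi\ge G_{mi}$ for $|\Phi|>\tilde\Phi_{Mi}$. Convergence of a solution to a set means that its distance from the set tends to $0$ as $t\to+\infty$. *)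

theory Defs
  imports "HOL-Analysis.Analysis" "Graph_Theory.Graph_Theory"
begin

section \<open>Loops, spanning trees and fundamental cut-sets of a digraph\<close>

text \<open>
  Circuit theory ignores branch orientation when speaking of connectedness, loops and trees,
  whereas \<^const>\<open>pre_digraph.cycle\<close> and \<^const>\<open>spanning_tree\<close> are directed notions.
  Undirected walks are obtained by letting every branch \<open>e\<close> be traversed forwards,
  as \<open>(e, True)\<close>, or backwards, as \<open>(e, False)\<close>.
\<close>

definition bidirected :: "('v, 'b) pre_digraph \<Rightarrow> ('v, 'b \<times> bool) pre_digraph" where
  "bidirected G =
    \<lparr> verts = verts G, arcs = arcs G \<times> UNIV,
      tail = (\<lambda>(e, forwards). if forwards then tail G e else head G e),
      head = (\<lambda>(e, forwards). if forwards then head G e else tail G e) \<rparr>"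

text \<open>
  \<open>S\<close> is the branch set of a loop; distinctness of the branches excludes traversing a single
  branch back and forth, while two parallel branches do form a loop.
\<close>

definition is_loop :: "('v, 'b) pre_digraph \<Rightarrow> 'b set \<Rightarrow> bool" where
  "is_loop G S \<longleftrightarrow>
    (\<exists>p. pre_digraph.cycle (bidirected G) p \<and> distinct (map fst p) \<and> S = fst ` set p)"

definition is_spanning_tree :: "('v, 'b) pre_digraph \<Rightarrow> 'b set \<Rightarrow> bool" where
  "is_spanning_tree G T \<longleftrightarrow>
    T \<subseteq> arcs G \<and> Digraph_Component.connected (G\<lparr>arcs := T\<rparr>) \<and> (\<nexists>S. is_loop (G\<lparr>arcs := T\<rparr>) S)"

definition is_fundamental_loop ::
    "('v, 'b) pre_digraph \<Rightarrow> 'b set \<Rightarrow> 'b \<Rightarrow> 'b set \<Rightarrow> bool" where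
  "is_fundamental_loop G T l S \<longleftrightarrow> is_loop (G\<lparr>arcs := insert l T\<rparr>) S \<and> l \<in> S"

text \<open>
  Removing the tree branch \<open>t\<close> splits the spanning tree into two parts; this is the node set
  of the part that contains the tail of \<open>t\<close>.
\<close>

definition cut_side :: "('v, 'b) pre_digraph \<Rightarrow> 'b set \<Rightarrow> 'b \<Rightarrow> 'v set" where
  "cut_side G T t =
    {v. reachable (with_proj (mk_symmetric (G\<lparr>arcs := T - {t}\<rparr>))) (tail G t) v}"

text \<open>
  Adding up Kirchhoff's charge law (charges leaving minus charges entering) over the nodes in
  \<^term>\<open>cut_side G T t\<close>, every branch \<open>e\<close> contributes its charge with the following factor.
  It is 1 for \<open>e = t\<close> and 0 for the other tree branches, so that the law of the fundamental
  cut-set of \<open>t\<close> reads \<open>q\<^sub>t + (\<Sum>l. cutset_coeff G T t l * q\<^sub>l) = 0\<close>, with \<open>l\<close> ranging over the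
  co-tree.
\<close>

definition cutset_coeff :: "('v, 'b) pre_digraph \<Rightarrow> 'b set \<Rightarrow> 'b \<Rightarrow> 'b \<Rightarrow> real" where
  "cutset_coeff G T t e =
    (if tail G e \<in> cut_side G T t then 1 else 0) - (if head G e \<in> cut_side G T t then 1 else 0)"

definition parallel_branches :: "('v, 'b) pre_digraph \<Rightarrow> 'b \<Rightarrow> 'b \<Rightarrow> bool" where
  "parallel_branches G a b \<longleftrightarrow> {tail G a, head G a} = {tail G b, head G b}"


section \<open>Circuits\<close>

text \<open>
  The finite types \<open>'c\<close> and \<open>'l\<close> index the capacitive and the inductive branches, so
  \<open>n\<^sub>C = CARD('c)\<close> and \<open>n\<^sub>L = CARD('l)\<close>. The resistors are those \<open>r :: 'r\<close> with
  \<^term>\<open>Res r \<in> arcs G\<close>, since there may be no resistors at all. A capacitor and the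
  memristor in parallel with it form a single branch \<^term>\<open>Cap i\<close>.
\<close>

datatype ('c, 'l, 'r) branch = Cap 'c | Ind 'l | Res 'r

type_synonym ('v, 'c, 'l, 'r) circuit_graph = "('v, ('c, 'l, 'r) branch) pre_digraph"

definition is_circuit ::
    "('v, 'c, 'l, 'r) circuit_graph \<Rightarrow> ('c \<Rightarrow> real) \<Rightarrow> ('l \<Rightarrow> real) \<Rightarrow> ('r \<Rightarrow> real) \<Rightarrow> bool" where
  "is_circuit G C L R \<longleftrightarrow>
    fin_digraph G \<and> Digraph_Component.connected G \<and>
    range Cap \<subseteq> arcs G \<and> range Ind \<subseteq> arcs G \<and>
    (\<forall>i. C i > 0) \<and> (\<forall>l. L l > 0) \<and> (\<forall>r. Res r \<in> arcs G \<longrightarrow> R r \<noteq> 0)"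

definition topological_assumption ::
    "('v, 'c, 'l, 'r) circuit_graph \<Rightarrow> ('c, 'l, 'r) branch set \<Rightarrow> bool" where
  "topological_assumption G T \<longleftrightarrow>
    is_spanning_tree G T \<and>
    range Cap \<subseteq> T \<and> T \<subseteq> range Cap \<union> range Res \<and>
    (\<forall>r S. Res r \<in> arcs G - T \<and> is_fundamental_loop G T (Res r) S \<longrightarrow> S - {Res r} \<subseteq> range Cap)"

text \<open>The parameter \<open>\<Phi>\<close> is the threshold beyond which the slope bound \<open>Gm\<close> holds.\<close>

definition memristor_assumption :: "(real \<Rightarrow> real) \<Rightarrow> real \<Rightarrow> real \<Rightarrow> bool" where
  "memristor_assumption Q Gm \<Phi> \<longleftrightarrow>
    (\<exists>Q'. (\<forall>x. (Q has_real_derivative Q' x) (at x)) \<and> continuous_on UNIV Q' \<and> (\<forall>x. Q' x \<ge> 0)) \<and>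
    Q 0 = 0 \<and> Gm > 0 \<and> \<Phi> > 0 \<and> (\<forall>x. \<bar>x\<bar> > \<Phi> \<longrightarrow> Q x / x \<ge> Gm)"

definition active_resistors :: "('v, 'c, 'l, 'r) circuit_graph \<Rightarrow> ('r \<Rightarrow> real) \<Rightarrow> 'r set" where
  "active_resistors G R = {r. Res r \<in> arcs G \<and> R r < 0}"


section \<open>Matrices\<close>

definition diagonal_matrix :: "('n \<Rightarrow> real) \<Rightarrow> real^'n^'n" where
  "diagonal_matrix d = (\<chi> i j. if i = j then d i else 0)"

definition block_vector :: "real^'m \<Rightarrow> real^'n \<Rightarrow> real^('m + 'n)" where
  "block_vector x y = (\<chi> k. case k of Inl i \<Rightarrow> x $ i | Inr j \<Rightarrow> y $ j)"

definition block_row :: "real^'m^'p \<Rightarrow> real^'n^'p \<Rightarrow> real^('m + 'n)^'p" where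
  "block_row A B = (\<chi> i. block_vector (A $ i) (B $ i))"

definition block_matrix ::
    "real^'m^'p \<Rightarrow> real^'n^'p \<Rightarrow> real^'m^'q \<Rightarrow> real^'n^'q \<Rightarrow> real^('m + 'n)^('p + 'q)" where
  "block_matrix A B C D =
    (\<chi> k. case k of Inl i \<Rightarrow> block_row A B $ i | Inr j \<Rightarrow> block_row C D $ j)"

definition positive_definite :: "real^'n^'n \<Rightarrow> bool" where
  "positive_definite A \<longleftrightarrow> transpose A = A \<and> (\<forall>x. x \<noteq> 0 \<longrightarrow> x \<bullet> (A *v x) > 0)"

definition spectral_norm :: "real^'n^'m \<Rightarrow> real" where
  "spectral_norm A = onorm (\<lambda>x. A *v x)"

text \<open>
  Rows or columns belonging to tree (co-tree) resistors are indexed by the whole type \<open>'r\<close>: the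
  entries at all other indices are 0 in \<open>A_CR\<close> and \<open>A_RL\<close>, and 1 on the diagonals of
  \<open>R_tree\<close> and \<open>R_cotree\<close>. This padding changes neither the products defining \<open>H_aa\<close> and
  \<open>H_bb\<close> nor the rank of \<open>(A_CL, A_CR)\<close>, and it also covers an empty set of tree or
  co-tree resistors.
\<close>

definition A_CL ::
    "('v, 'c, 'l, 'r) circuit_graph \<Rightarrow> ('c, 'l, 'r) branch set \<Rightarrow> real^'l^'c" where
  "A_CL G T = (\<chi> i l. cutset_coeff G T (Cap i) (Ind l))"

definition A_CR ::
    "('v, 'c, 'l, 'r) circuit_graph \<Rightarrow> ('c, 'l, 'r) branch set \<Rightarrow> real^'r^'c" where
  "A_CR G T =
    (\<chi> i r. if Res r \<in> arcs G - T then cutset_coeff G T (Cap i) (Res r) else 0)"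

definition A_RL ::
    "('v, 'c, 'l, 'r) circuit_graph \<Rightarrow> ('c, 'l, 'r) branch set \<Rightarrow> real^'l^'r" where
  "A_RL G T = (\<chi> r l. if Res r \<in> T then cutset_coeff G T (Res r) (Ind l) else 0)"

definition R_tree :: "('c, 'l, 'r) branch set \<Rightarrow> ('r \<Rightarrow> real) \<Rightarrow> real^'r^'r" where
  "R_tree T R = diagonal_matrix (\<lambda>r. if Res r \<in> T then R r else 1)"

definition R_cotree ::
    "('v, 'c, 'l, 'r) circuit_graph \<Rightarrow> ('c, 'l, 'r) branch set \<Rightarrow> ('r \<Rightarrow> real) \<Rightarrow> real^'r^'r" where
  "R_cotree G T R = diagonal_matrix (\<lambda>r. if Res r \<in> arcs G - T then R r else 1)"

definition H_aa ::
    "('v, 'c, 'l, 'r::finite) circuit_graph \<Rightarrow> ('c, 'l, 'r) branch set \<Rightarrow> ('r \<Rightarrow> real)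
      \<Rightarrow> real^'c^'c" where
  "H_aa G T R = A_CR G T ** matrix_inv (R_cotree G T R) ** transpose (A_CR G T)"

definition H_ab ::
    "('v, 'c, 'l, 'r) circuit_graph \<Rightarrow> ('c, 'l, 'r) branch set \<Rightarrow> real^'l^'c" where
  "H_ab G T = A_CL G T"

definition H_bb ::
    "('v, 'c, 'l, 'r::finite) circuit_graph \<Rightarrow> ('c, 'l, 'r) branch set \<Rightarrow> ('r \<Rightarrow> real)
      \<Rightarrow> real^'l^'l" where
  "H_bb G T R = transpose (A_RL G T) ** R_tree T R ** A_RL G T"

definition H_matrix ::
    "('v, 'c::finite, 'l::finite, 'r::finite) circuit_graph \<Rightarrow> ('c, 'l, 'r) branch set \<Rightarrow> ('r \<Rightarrow> real)
      \<Rightarrow> real^('c + 'l)^('c + 'l)" where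
  "H_matrix G T R =
    block_matrix (H_aa G T R) (H_ab G T) (- transpose (H_ab G T)) (H_bb G T R)"


section \<open>State equations in the flux-charge domain\<close>

text \<open>
  \<open>M\<close> is the set of (indices of) capacitive branches with a memristor; \<open>Q i\<close> and \<open>\<Phi>0 i\<close> are
  relevant for \<open>i \<in> M\<close> only.
\<close>

definition memristor_charge ::
    "'c set \<Rightarrow> ('c \<Rightarrow> real \<Rightarrow> real) \<Rightarrow> ('c \<Rightarrow> real) \<Rightarrow> real^'c \<Rightarrow> real^'c" where
  "memristor_charge M Q \<Phi>0 \<phi> =
    (\<chi> i. if i \<in> M then Q i (\<phi> $ i + \<Phi>0 i) - Q i (\<Phi>0 i) else 0)"

definition state_rhs ::
    "real^('c::finite + 'l::finite)^('c + 'l) \<Rightarrow> ('c \<Rightarrow> real) \<Rightarrow> ('l \<Rightarrow> real) \<Rightarrow>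
     'c set \<Rightarrow> ('c \<Rightarrow> real \<Rightarrow> real) \<Rightarrow> ('c \<Rightarrow> real) \<Rightarrow> real^'c \<Rightarrow> real^'l \<Rightarrow>
     (real^'c) \<times> (real^'l) \<Rightarrow> real^('c + 'l)" where
  "state_rhs H C L M Q \<Phi>0 v0 i0 = (\<lambda>(\<phi>, q).
    - (H *v block_vector \<phi> q) - block_vector (memristor_charge M Q \<Phi>0 \<phi>) 0
    + block_vector (diagonal_matrix C *v v0) (diagonal_matrix L *v i0))"

definition solves_state_equations ::
    "real^('c::finite + 'l::finite)^('c + 'l) \<Rightarrow> ('c \<Rightarrow> real) \<Rightarrow> ('l \<Rightarrow> real) \<Rightarrow>
     'c set \<Rightarrow> ('c \<Rightarrow> real \<Rightarrow> real) \<Rightarrow> ('c \<Rightarrow> real) \<Rightarrow> real^'c \<Rightarrow> real^'l \<Rightarrow>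
     (real \<Rightarrow> (real^'c) \<times> (real^'l)) \<Rightarrow> real set \<Rightarrow> bool" where
  "solves_state_equations H C L M Q \<Phi>0 v0 i0 x J \<longleftrightarrow>
    (\<forall>t\<in>J. \<exists>\<phi>' q'. (x has_vector_derivative (\<phi>', q')) (at t within J) \<and>
      block_vector (diagonal_matrix C *v \<phi>') (diagonal_matrix L *v q') =
      state_rhs H C L M Q \<Phi>0 v0 i0 (x t))"

definition equilibria ::
    "real^('c::finite + 'l::finite)^('c + 'l) \<Rightarrow> ('c \<Rightarrow> real) \<Rightarrow> ('l \<Rightarrow> real) \<Rightarrow>
     'c set \<Rightarrow> ('c \<Rightarrow> real \<Rightarrow> real) \<Rightarrow> ('c \<Rightarrow> real) \<Rightarrow> real^'c \<Rightarrow> real^'l \<Rightarrow>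
     ((real^'c) \<times> (real^'l)) set" where
  "equilibria H C L M Q \<Phi>0 v0 i0 = {x. state_rhs H C L M Q \<Phi>0 v0 i0 x = 0}"

text \<open>Nonemptiness is required because \<^term>\<open>infdist x {} = 0\<close>.\<close>

definition converges_to_set :: "(real \<Rightarrow> 'a::metric_space) \<Rightarrow> 'a set \<Rightarrow> bool" where
  "converges_to_set x E \<longleftrightarrow> E \<noteq> {} \<and> ((\<lambda>t. infdist (x t) E) \<longlongrightarrow> 0) at_top"

end

theory Submission
  imports Defs
begin

text \<open>
  Let \<open>P\<close> be the mixed potential of the flux-charge equations, which read
  \<open>C \<phi>' = - \<partial>P/\<partial>\<phi>\<close> and \<open>L q' = \<partial>P/\<partial>q =: y\<close>. Following Brayton and Moser,
  \<open>W = P + y \<bullet> (H\<^sub>\<beta>\<^sub>\<beta>\<^sup>-\<^sup>1 y)\<close> has the derivative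
  \<open>- |C\<^sup>1\<^sup>/\<^sup>2 \<phi>'|\<^sup>2 - |L\<^sup>1\<^sup>/\<^sup>2 q'|\<^sup>2 + 2 (L\<^sup>1\<^sup>/\<^sup>2 q') \<bullet> (L\<^sup>1\<^sup>/\<^sup>2 H\<^sub>\<beta>\<^sub>\<beta>\<^sup>-\<^sup>1 H\<^sub>\<alpha>\<^sub>\<beta>\<^sup>T \<phi>')\<close>
  along solutions, so the norm condition bounds it by \<open>- \<delta> |(\<phi>', q')|\<^sup>2\<close>. Completing the square in
  \<open>q\<close> turns \<open>W\<close> into a function of \<open>\<phi>\<close> plus a positive definite form in \<open>y\<close>. The quadratic part of
  the former is \<open>H\<^sub>\<alpha>\<^sub>\<alpha> + H\<^sub>\<alpha>\<^sub>\<beta> H\<^sub>\<beta>\<^sub>\<beta>\<^sup>-\<^sup>1 H\<^sub>\<alpha>\<^sub>\<beta>\<^sup>T\<close> plus the asymptotic slopes \<open>Gm\<close> of the memristors,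
  which outweigh the active resistors; by the rank condition it is positive definite, so \<open>W\<close> is coercive.
  Hence solutions are bounded, and their velocity tends to 0 because each excursion of the velocity away
  from 0 lasts for a time bounded below and thus costs a fixed amount of \<open>W\<close>.
\<close>

section \<open>Matrices\<close>

text \<open>This rule would turn every \<open>transpose A *v x\<close> into \<open>x v* A\<close>;
  the proofs below move transposes across inner products and need them in the first form.\<close>

declare transpose_matrix_vector [simp del]

lemma diagonal_matrix_mult_vector: "diagonal_matrix d *v x = (\<chi> i. d i * x $ i)"
proof -
  have "(\<Sum>j\<in>UNIV. (if i = j then d i else 0) * x $ j) = d i * x $ i" for i
    by (subst sum.cong[OF refl, of _ _ "\<lambda>j. if i = j then d i * x $ j else 0"]) auto
  then show ?thesis
    by (simp add: diagonal_matrix_def matrix_vector_mult_def)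
qed

lemma transpose_diagonal_matrix: "transpose (diagonal_matrix d) = diagonal_matrix d"
  by (simp add: diagonal_matrix_def transpose_def vec_eq_iff)

text \<open>\<open>matrix_inv\<close> chooses some two-sided inverse, and two-sided inverses are
  unique.\<close>

lemma matrix_inv_eqI:
  fixes A B :: "real^'n^'n"
  assumes "A ** B = mat 1" "B ** A = mat 1"
  shows "matrix_inv A = B"
proof -
  have "A ** matrix_inv A = mat 1 \<and> matrix_inv A ** A = mat 1"
    unfolding matrix_inv_def by (rule someI[where x = B]) (use assms in simp)
  then show ?thesis
    using assms by (metis matrix_mul_assoc matrix_mul_lid matrix_mul_rid)
qed

lemma matrix_inv_diagonal:
  assumes "\<And>i. d i \<noteq> 0"
  shows "matrix_inv (diagonal_matrix d) = diagonal_matrix (\<lambda>i. 1 / d i)"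
  by (rule matrix_inv_eqI; subst matrix_eq)
    (use assms in \<open>simp_all add: matrix_vector_mul_assoc [symmetric] diagonal_matrix_mult_vector\<close>)

lemma diagonal_matrix_mult_inverse:
  assumes "\<And>i. d i \<noteq> 0"
  shows "diagonal_matrix d *v (diagonal_matrix (\<lambda>i. 1 / d i) *v w) = w"
  using assms by (simp add: diagonal_matrix_mult_vector vec_eq_iff)

lemma diagonal_matrix_mult_eq_iff:
  assumes "\<And>i. d i \<noteq> 0"
  shows "diagonal_matrix d *v w = diagonal_matrix d *v w' \<longleftrightarrow> w = w'"
  using assms by (simp add: diagonal_matrix_mult_vector vec_eq_iff)

section \<open>Symmetric and positive definite matrices\<close>

lemma transpose_mult_inner: "(transpose A *v x) \<bullet> y = x \<bullet> (A *v y)" for A :: "real^'n^'m"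
  by (simp add: transpose_matrix_vector dot_lmul_matrix)

lemma symmetric_mult_inner: "transpose A = A \<Longrightarrow> (A *v x) \<bullet> y = x \<bullet> (A *v y)" for A :: "real^'n^'n"
  by (metis transpose_mult_inner)

text \<open>A vector in the kernel of \<open>D\<close> makes the form vanish and is therefore 0, so
  \<open>D\<close> is invertible. Positivity passes to the inverse by evaluating the form of
  \<open>D\<close> at \<open>matrix_inv D *v x\<close>.\<close>

lemma positive_definite_inverse:
  fixes D :: "real^'n^'n"
  assumes "positive_definite D"
  shows "D *v (matrix_inv D *v x) = x" "matrix_inv D *v (D *v x) = x"
    and "positive_definite (matrix_inv D)"
proof -
  have "inj ((*v) D)"
    using assms unfolding positive_definite_def
    by (metis inner_zero_right matrix_left_invertible_injective matrix_left_invertible_ker less_irrefl)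
  then have inv: "invertible D"
    by (simp add: invertible_left_inverse matrix_left_invertible_injective)
  then have *: "D ** matrix_inv D = mat 1" "matrix_inv D ** D = mat 1"
    using matrix_inv_eqI unfolding invertible_def by metis+
  then show 1: "D *v (matrix_inv D *v x) = x" "matrix_inv D *v (D *v x) = x" for x
    by (simp_all add: matrix_vector_mul_assoc)
  have D: "transpose D = D" using assms by (simp add: positive_definite_def)
  have "transpose (matrix_inv D) = matrix_inv D"
    using arg_cong[OF *(1), of transpose] arg_cong[OF *(2), of transpose] D
    by (metis matrix_inv_eqI matrix_transpose_mul transpose_mat)
  moreover have "x \<bullet> (matrix_inv D *v x) > 0" if "x \<noteq> 0" for x
  proof -
    have "matrix_inv D *v x \<noteq> 0" using 1(1)[of x] that by auto
    then have "(matrix_inv D *v x) \<bullet> (D *v (matrix_inv D *v x)) > 0"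
      using assms by (simp add: positive_definite_def)
    then show ?thesis by (simp add: 1 inner_commute)
  qed
  ultimately show "positive_definite (matrix_inv D)" by (simp add: positive_definite_def)
qed

text \<open>By compactness the form attains a minimum on the unit sphere. This minimum is positive
  and serves as \<open>c\<close>, since the form is homogeneous of degree 2.\<close>

lemma positive_form_coercive:
  fixes A :: "real^'n^'n"
  assumes "\<And>x. x \<noteq> 0 \<Longrightarrow> x \<bullet> (A *v x) > 0"
  obtains c where "c > 0" "\<And>x. c * (norm x)\<^sup>2 \<le> x \<bullet> (A *v x)"
proof -
  have "compact (sphere (0::real^'n) 1)" "sphere (0::real^'n) 1 \<noteq> {}"
    by (auto simp: sphere_eq_empty)
  moreover have "continuous_on (sphere 0 1) (\<lambda>z. z \<bullet> (A *v z))"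
    by (intro continuous_intros matrix_vector_mult_linear_continuous_on)
  ultimately obtain z where z: "z \<in> sphere 0 1" "\<And>y. y \<in> sphere 0 1 \<Longrightarrow> z \<bullet> (A *v z) \<le> y \<bullet> (A *v y)"
    using continuous_attains_inf[of "sphere 0 1" "\<lambda>z. z \<bullet> (A *v z)"]
    by blast
  have "(z \<bullet> (A *v z)) * (norm x)\<^sup>2 \<le> x \<bullet> (A *v x)" for x
  proof (cases "x = 0")
    case False
    then have "x /\<^sub>R norm x \<in> sphere 0 1" by simp
    then have "z \<bullet> (A *v z) \<le> (x /\<^sub>R norm x) \<bullet> (A *v (x /\<^sub>R norm x))" using z(2) by blast
    also have "\<dots> = (x \<bullet> (A *v x)) / (norm x)\<^sup>2"
      by (simp add: matrix_vector_mult_scaleR power2_eq_square divide_inverse)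
    finally show ?thesis using False by (simp add: pos_le_divide_eq)
  qed simp
  moreover have "z \<noteq> 0" using z(1) by auto
  then have "z \<bullet> (A *v z) > 0" by (rule assms)
  ultimately show thesis using that by blast
qed

section \<open>Block vectors and block matrices\<close>

lemma block_vector_eq_iff: "block_vector x y = block_vector x' y' \<longleftrightarrow> x = x' \<and> y = y'"
proof
  assume "block_vector x y = block_vector x' y'"
  then have "block_vector x y $ k = block_vector x' y' $ k" for k by simp
  from this[of "Inl _"] this[of "Inr _"] show "x = x' \<and> y = y'"
    by (simp add: block_vector_def vec_eq_iff)
qed simp

lemma block_vector_arith:
  "block_vector x y + block_vector x' y' = block_vector (x + x') (y + y')"
  "block_vector x y - block_vector x' y' = block_vector (x - x') (y - y')"
  "- block_vector x y = block_vector (- x) (- y)"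
  "0 = block_vector 0 0"
  by (simp_all add: block_vector_def vec_eq_iff split: sum.split)

lemma block_vector_inner: "block_vector x y \<bullet> block_vector x' y' = x \<bullet> x' + y \<bullet> y'"
  by (simp add: inner_vec_def block_vector_def UNIV_Plus_UNIV[symmetric] sum.Plus
      del: UNIV_Plus_UNIV)

lemma block_matrix_mult_block_vector:
  "block_matrix A B C D *v block_vector x y = block_vector (A *v x + B *v y) (C *v x + D *v y)"
  by (simp add: vec_eq_iff matrix_vector_mul_component block_vector_inner block_matrix_def
      block_row_def block_vector_def[of "_ + _"] split: sum.split)

text \<open>Full row rank makes the transpose injective, and the transpose of the block row stacks
  the two transposes that annihilate \<open>x\<close>.\<close>

lemma block_row_full_rank:
  fixes A :: "real^'m^'p" and B :: "real^'n^'p"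
  assumes "rank (block_row A B) = CARD('p)" "transpose A *v x = 0" "transpose B *v x = 0"
  shows "x = 0"
proof -
  have *: "block_row A B *v block_vector y z = A *v y + B *v z" for y z
    by (simp add: vec_eq_iff matrix_vector_mul_component block_vector_inner block_row_def)
  have split: "\<exists>y z. w = block_vector y z" for w :: "real^('m + 'n)"
    by (rule exI[of _ "\<chi> i. w $ Inl i"], rule exI[of _ "\<chi> i. w $ Inr i"])
      (auto simp: vec_eq_iff block_vector_def split: sum.split)
  have "(transpose (block_row A B) *v x) \<bullet> w = 0" for w
  proof -
    obtain y z where w: "w = block_vector y z" using split by blast
    have "(transpose (block_row A B) *v x) \<bullet> w = (transpose A *v x) \<bullet> y + (transpose B *v x) \<bullet> z"
      unfolding transpose_mult_inner w * by (rule inner_add_right)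
    then show ?thesis by (simp only: assms inner_zero_left add_0)
  qed
  then have "transpose (block_row A B) *v x = 0" by (metis inner_eq_zero_iff)
  moreover have "inj ((*v) (transpose (block_row A B)))"
    using assms(1) by (metis rank_transpose full_rank_injective)
  ultimately show ?thesis by (metis injD matrix_vector_mult_0_right)
qed

section \<open>Cut-sets\<close>

lemma abs_cutset_coeff_le_1: "\<bar>cutset_coeff G T t e\<bar> \<le> 1"
  by (simp add: cutset_coeff_def)

text \<open>The branch \<open>s\<close> survives the removal of \<open>t\<close>, so its two ends
  lie on the same side of the cut. The branch \<open>e\<close> has the same ends, and its two
  contributions cancel.\<close>

lemma cutset_coeff_parallel_tree_branch:
  assumes "wf_digraph G" "s \<in> T" "s \<noteq> t" "s \<in> arcs G" "parallel_branches G e s"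
  shows "cutset_coeff G T t e = 0"
proof -
  let ?r = "arcs_ends (with_proj (mk_symmetric (G\<lparr>arcs := T - {t}\<rparr>)))"
  have ends: "tail G s \<in> verts G" "head G s \<in> verts G"
    using assms(1,4) by (auto simp: wf_digraph_def)
  have "(tail G s, head G s) \<in> ?r" "(head G s, tail G s) \<in> ?r"
    using assms(2,3) by (auto simp: arcs_ends_def arc_to_ends_def parcs_mk_symmetric)
  then have "tail G s \<in> cut_side G T t \<longleftrightarrow> head G s \<in> cut_side G T t"
    using ends unfolding cut_side_def reachable_def
    by (auto intro: rtrancl_on_into_rtrancl_on)
  moreover have "tail G e \<in> {tail G s, head G s}" "head G e \<in> {tail G s, head G s}"
    using assms(5) by (auto simp: parallel_branches_def)
  ultimately show ?thesis by (auto simp: cutset_coeff_def)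
qed

section \<open>Convergence of trajectories with a strict Lyapunov function\<close>

text \<open>On the compact orbit closure \<open>f\<close> is bounded and uniformly continuous, so a
  velocity of norm at least \<epsilon> stays above \<epsilon>/2 for a time \<open>h\<close>
  independent of the starting time. Each such excursion lowers \<open>V\<close> by a fixed amount,
  which is impossible once \<open>V\<close> is close to its infimum.\<close>

lemma dissipation_imp_velocity_vanishes:
  fixes x :: "real \<Rightarrow> 'a::euclidean_space" and f :: "'a \<Rightarrow> 'a" and V V' :: "real \<Rightarrow> real"
  assumes f: "continuous_on UNIV f"
    and x: "\<And>t. 0 \<le> t \<Longrightarrow> (x has_vector_derivative f (x t)) (at t within {0..})"
    and bdd: "bounded (x ` {0..})"
    and V: "\<And>t. 0 \<le> t \<Longrightarrow> (V has_real_derivative V' t) (at t within {0..})"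
    and diss: "\<delta> > 0" "\<And>t. 0 \<le> t \<Longrightarrow> V' t \<le> - \<delta> * (norm (f (x t)))\<^sup>2"
    and below: "\<And>t. 0 \<le> t \<Longrightarrow> m \<le> V t"
  shows "((\<lambda>t. f (x t)) \<longlongrightarrow> 0) at_top"
proof (rule tendstoI)
  fix \<epsilon> :: real assume "\<epsilon> > 0"
  let ?K = "closure (x ` {0..})"
  have xK: "x t \<in> ?K" if "0 \<le> t" for t
    using closure_subset[of "x ` {0..}"] that by auto
  have K: "compact ?K" using bdd by (simp add: compact_closure)
  have fK: "continuous_on ?K f" using f continuous_on_subset by blast
  then have "bounded (f ` ?K)" using K compact_continuous_image compact_imp_bounded by blast
  then obtain B where B: "B > 0" "\<And>z. z \<in> ?K \<Longrightarrow> norm (f z) \<le> B"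
    by (auto simp: bounded_pos)
  have lip: "norm (x s - x t) \<le> B * norm (s - t)" if "0 \<le> s" "0 \<le> t" for s t
  proof (rule differentiable_bound[of "{0..}" x "\<lambda>t h. h *\<^sub>R f (x t)"])
    show "(x has_derivative (\<lambda>h. h *\<^sub>R f (x t))) (at t within {0..})" if "t \<in> {0..}" for t
      using x that by (simp add: has_vector_derivative_def)
    show "onorm (\<lambda>h. h *\<^sub>R f (x t)) \<le> B" if "t \<in> {0..}" for t
      using that B(2)[OF xK] by (simp add: onorm_scaleR_left onorm_id)
  qed (use that in auto)
  have "uniformly_continuous_on ?K f" using compact_uniformly_continuous[OF fK K] .
  then obtain d where d: "d > 0"
    "\<And>y z. y \<in> ?K \<Longrightarrow> z \<in> ?K \<Longrightarrow> dist z y < d \<Longrightarrow> dist (f z) (f y) < \<epsilon> / 2"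
    using \<open>\<epsilon> > 0\<close> unfolding uniformly_continuous_on_def by (metis half_gt_zero)
  \<comment> \<open>Within time \<open>h\<close> the trajectory moves by at most
    \<open>B * h = d / 2\<close>, which is less than the modulus of continuity
    \<open>d\<close>.\<close>
  define h where "h = d / (2 * B)"
  have h: "h > 0" "B * h < d" using d(1) B(1) by (auto simp: h_def)
  have mvt: "\<exists>\<xi>\<in>{a<..<b}. V b - V a = V' \<xi> * (b - a)" if "0 \<le> a" "a < b" for a b
    using mvt_simple[of a b V "\<lambda>t h. V' t * h"] V that
    by (meson atLeastAtMost_iff atLeast_iff has_derivative_subset has_field_derivative_def order_trans subsetI)
  have decr: "V b \<le> V a" if "0 \<le> a" "a \<le> b" for a b
  proof (cases "a < b")
    case True
    then obtain \<xi> where \<xi>: "\<xi> \<in> {a<..<b}" "V b - V a = V' \<xi> * (b - a)" using mvt \<open>0 \<le> a\<close> by blast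
    have "V' \<xi> \<le> - (\<delta> * (norm (f (x \<xi>)))\<^sup>2)" using diss(2)[of \<xi>] \<xi>(1) that by auto
    also have "\<dots> \<le> 0" using diss(1) by simp
    finally have "V' \<xi> * (b - a) \<le> 0" using that by (simp add: mult_nonpos_nonneg)
    then show ?thesis using \<xi>(2) by simp
  qed (use that in auto)
  define v where "v = Inf (V ` {0..})"
  have bb: "bdd_below (V ` {0..})" using below by (auto intro: bdd_belowI[of _ m])
  \<comment> \<open>The least drop of \<open>V\<close> over an interval of length \<open>h\<close>
    on which the velocity has norm at least \<epsilon>/2.\<close>
  define \<eta> where "\<eta> = \<delta> * (\<epsilon> / 2)\<^sup>2 * h"
  have "\<eta> > 0" using diss(1) \<open>\<epsilon> > 0\<close> h(1) by (simp add: \<eta>_def)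
  then have "Inf (V ` {0..}) < v + \<eta>" by (simp add: v_def)
  then obtain t0 where t0: "t0 \<ge> 0" "V t0 < v + \<eta>"
    using cInf_lessD[of "V ` {0..}" "v + \<eta>"] by auto
  have "norm (f (x t)) < \<epsilon>" if "t \<ge> t0" for t
  proof (rule ccontr)
    assume big: "\<not> norm (f (x t)) < \<epsilon>"
    have "t \<ge> 0" using that t0 by simp
    obtain \<xi> where \<xi>: "\<xi> \<in> {t<..<t + h}" "V (t + h) - V t = V' \<xi> * h"
      using mvt[of t "t + h"] h(1) \<open>t \<ge> 0\<close> by auto
    have "\<xi> \<ge> 0" using \<xi> \<open>t \<ge> 0\<close> by simp
    have "norm (x \<xi> - x t) \<le> B * norm (\<xi> - t)" using lip \<open>\<xi> \<ge> 0\<close> \<open>t \<ge> 0\<close> by blast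
    also have "\<dots> \<le> B * h" using \<xi>(1) B(1) by simp
    finally have "dist (f (x \<xi>)) (f (x t)) < \<epsilon> / 2"
      using h(2) d(2)[OF xK xK] \<open>\<xi> \<ge> 0\<close> \<open>t \<ge> 0\<close> by (simp add: dist_norm)
    then have "norm (f (x \<xi>)) \<ge> \<epsilon> / 2"
      using big norm_triangle_ineq2[of "f (x t)" "f (x \<xi>)"] by (simp add: dist_norm norm_minus_commute)
    then have "(\<epsilon> / 2)\<^sup>2 \<le> (norm (f (x \<xi>)))\<^sup>2" using \<open>\<epsilon> > 0\<close> by (intro power_mono) auto
    then have "\<delta> * (\<epsilon> / 2)\<^sup>2 \<le> \<delta> * (norm (f (x \<xi>)))\<^sup>2" using diss(1) by (intro mult_left_mono) auto
    then have "V' \<xi> \<le> - (\<delta> * (\<epsilon> / 2)\<^sup>2)" using diss(2)[OF \<open>\<xi> \<ge> 0\<close>] by simp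
    then have "V' \<xi> * h \<le> - \<eta>" using mult_right_mono[of "V' \<xi>" "- (\<delta> * (\<epsilon> / 2)\<^sup>2)" h] h(1) by (simp add: \<eta>_def)
    moreover have "v \<le> V (t + h)" unfolding v_def using bb \<open>t \<ge> 0\<close> h(1) by (intro cInf_lower) auto
    ultimately show False using \<xi>(2) decr[OF t0(1) that] t0(2) by simp
  qed
  then show "\<forall>\<^sub>F t in at_top. dist (f (x t)) 0 < \<epsilon>"
    by (auto simp: eventually_at_top_linorder)
qed

text \<open>The norm of \<open>f\<close> has a positive minimum on \<open>K\<close>, and the
  velocity eventually falls below it.\<close>

lemma velocity_vanishes_imp_leaves_compact:
  fixes x :: "real \<Rightarrow> 'a::euclidean_space" and f :: "'a \<Rightarrow> 'a"
  assumes f: "continuous_on UNIV f" and lim: "((\<lambda>t. f (x t)) \<longlongrightarrow> 0) at_top"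
    and K: "compact K" "\<And>z. z \<in> K \<Longrightarrow> f z \<noteq> 0"
  shows "\<forall>\<^sub>F t in at_top. x t \<notin> K"
proof (cases "K = {}")
  case False
  have "continuous_on K (\<lambda>z. norm (f z))"
    using f by (intro continuous_intros) (auto intro: continuous_on_subset)
  then obtain z where z: "z \<in> K" "\<And>y. y \<in> K \<Longrightarrow> norm (f z) \<le> norm (f y)"
    using continuous_attains_inf[OF K(1) False] by blast
  have "norm (f z) > 0" using z(1) K(2) by simp
  with lim have "\<forall>\<^sub>F t in at_top. dist (f (x t)) 0 < norm (f z)" by (rule tendstoD)
  then show ?thesis by eventually_elim (use z(2) in force)
qed simp

text \<open>The points of the orbit closure at distance at least \<epsilon> from the zero set of
  \<open>f\<close> form a compact set without zeros, which the trajectory must leave for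
  good.\<close>

lemma velocity_vanishes_imp_converges_to_set:
  fixes x :: "real \<Rightarrow> 'a::euclidean_space" and f :: "'a \<Rightarrow> 'a"
  assumes f: "continuous_on UNIV f" and lim: "((\<lambda>t. f (x t)) \<longlongrightarrow> 0) at_top"
    and bdd: "bounded (x ` {0..})"
  shows "converges_to_set x {z. f z = 0}"
proof -
  let ?K = "closure (x ` {0..})" and ?E = "{z. f z = 0}"
  have xK: "x t \<in> ?K" if "0 \<le> t" for t
    using closure_subset[of "x ` {0..}"] that by auto
  have K: "compact ?K" using bdd by (simp add: compact_closure)
  \<comment> \<open>Without zeros of \<open>f\<close> the trajectory would have to leave its own
    orbit closure.\<close>
  have "?E \<noteq> {}"
  proof
    assume "?E = {}"
    then have "\<forall>\<^sub>F t in at_top. x t \<notin> ?K"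
      by (intro velocity_vanishes_imp_leaves_compact[OF f lim K]) auto
    then have "\<forall>\<^sub>F t::real in at_top. False"
      using eventually_ge_at_top[of 0] by eventually_elim (use xK in blast)
    then show False by simp
  qed
  moreover have "((\<lambda>t. infdist (x t) ?E) \<longlongrightarrow> 0) at_top"
  proof (rule tendstoI)
    fix \<epsilon> :: real assume "\<epsilon> > 0"
    have "closed {z. \<epsilon> \<le> infdist z ?E}"
      by (intro closed_Collect_le continuous_intros)
    then have "compact (?K \<inter> {z. \<epsilon> \<le> infdist z ?E})" using K by (simp add: compact_Int_closed)
    then have "\<forall>\<^sub>F t in at_top. x t \<notin> ?K \<inter> {z. \<epsilon> \<le> infdist z ?E}"
      by (rule velocity_vanishes_imp_leaves_compact[OF f lim]) (use \<open>\<epsilon> > 0\<close> in auto)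
    then show "\<forall>\<^sub>F t in at_top. dist (infdist (x t) ?E) 0 < \<epsilon>"
      using eventually_ge_at_top[of 0]
      by eventually_elim (use xK in \<open>auto simp: infdist_nonneg\<close>)
  qed
  ultimately show ?thesis by (simp add: converges_to_set_def)
qed

text \<open>Compactness yields a limit point \<open>e\<close> of the trajectory, and
  \<open>e\<close> lies in \<open>E\<close>. Being isolated, it is the nearest point of
  \<open>E\<close> throughout a small ball. A trajectory close to \<open>E\<close> cannot cross the
  boundary of that ball, so it stays inside, where its distance from \<open>e\<close> is at most its
  distance from \<open>E\<close>.\<close>

lemma converges_to_isolated_set_imp_tendsto:
  fixes x :: "real \<Rightarrow> 'a::euclidean_space"
  assumes conv: "converges_to_set x E" and "closed E" and bdd: "bounded (x ` {0..})"
    and cont: "continuous_on {0..} x" and iso: "\<And>e. e \<in> E \<Longrightarrow> e isolated_in E"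
  shows "\<exists>e\<in>E. (x \<longlongrightarrow> e) at_top"
proof -
  have ne: "E \<noteq> {}" and lim: "((\<lambda>t. infdist (x t) E) \<longlongrightarrow> 0) at_top"
    using conv by (auto simp: converges_to_set_def)
  have "compact (closure (x ` {0..}))" using bdd by (simp add: compact_closure)
  moreover have "\<forall>n. x (real n) \<in> closure (x ` {0..})"
    using closure_subset[of "x ` {0..}"] by auto
  ultimately obtain e r where r: "strict_mono r" "((\<lambda>n. x (real n)) \<circ> r) \<longlonglongrightarrow> e"
    unfolding compact_def by (metis (no_types, lifting))
  have sub: "filterlim (\<lambda>n. real (r n)) at_top sequentially"
    using filterlim_compose[OF filterlim_real_sequentially filterlim_subseq[OF r(1)]] .
  have "(\<lambda>n. infdist (x (real (r n))) E) \<longlonglongrightarrow> infdist e E"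
    using tendsto_infdist[OF r(2)] by (simp add: o_def)
  moreover have "(\<lambda>n. infdist (x (real (r n))) E) \<longlonglongrightarrow> 0"
    using filterlim_compose[OF lim sub] .
  ultimately have "infdist e E = 0" by (rule LIMSEQ_unique)
  then have "e \<in> E" using \<open>closed E\<close> ne by (simp add: in_closed_iff_infdist_zero)
  then obtain \<rho> where \<rho>: "\<rho> > 0" "\<And>y. y \<in> E \<Longrightarrow> dist e y < \<rho> \<Longrightarrow> y = e"
    using iso by (metis isolated_in_dist_Ex_iff)
  \<comment> \<open>Any other point of \<open>E\<close> is at distance at least \<rho> from
    \<open>e\<close>, hence at least \<rho>/2 from \<open>z\<close>.\<close>
  have near: "dist z e \<le> infdist z E" if "dist z e \<le> \<rho> / 2" for z
  proof -
    obtain y where y: "y \<in> E" "infdist z E = dist z y"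
      using infdist_attains_inf[OF \<open>closed E\<close> ne] by blast
    show ?thesis
    proof (cases "y = e")
      case False
      then have "dist e y \<ge> \<rho>" using \<rho>(2) y(1) by fastforce
      then show ?thesis using y(2) that dist_triangle[of e y z] by (simp add: dist_commute)
    qed (use y in simp)
  qed
  have "\<forall>\<^sub>F t in at_top. dist (infdist (x t) E) 0 < \<rho> / 2"
    using lim \<rho>(1) by (intro tendstoD) auto
  then obtain t1 where t1: "\<And>t. t \<ge> t1 \<Longrightarrow> infdist (x t) E < \<rho> / 2"
    by (auto simp: eventually_at_top_linorder infdist_nonneg)
  have "\<forall>\<^sub>F n in sequentially. dist (x (real (r n))) e < \<rho> / 2"
    using tendstoD[OF r(2), of "\<rho> / 2"] \<rho>(1) by simp
  moreover have "\<forall>\<^sub>F n in sequentially. real (r n) \<ge> max 0 t1"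
    using sub by (simp add: filterlim_at_top)
  ultimately obtain n where n: "dist (x (real (r n))) e < \<rho> / 2" "real (r n) \<ge> max 0 t1"
    using eventually_happens'[OF sequentially_bot eventually_conj] by blast
  \<comment> \<open>Leaving the ball would, by the intermediate value theorem, produce a time at
    which the distance from \<open>e\<close> is exactly \<rho>/2; by \<open>near\<close> the
    distance from \<open>E\<close> would then be at least \<rho>/2 as well.\<close>
  have close: "dist (x t) e < \<rho> / 2" if "t \<ge> real (r n)" for t
  proof (rule ccontr)
    assume "\<not> dist (x t) e < \<rho> / 2"
    moreover have "continuous_on {real (r n)..t} (\<lambda>t. dist (x t) e)"
      by (intro continuous_intros continuous_on_subset[OF cont]) auto
    ultimately have "\<exists>s\<ge>real (r n). s \<le> t \<and> dist (x s) e = \<rho> / 2"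
      using n(1) that by (intro IVT') auto
    then obtain s where "s \<ge> real (r n)" "dist (x s) e = \<rho> / 2" by blast
    then show False using near[of "x s"] t1[of s] n(2) by simp
  qed
  have "((\<lambda>t. dist (x t) e) \<longlongrightarrow> 0) at_top"
  proof (rule tendsto_sandwich[OF _ _ tendsto_const lim])
    show "\<forall>\<^sub>F t in at_top. dist (x t) e \<le> infdist (x t) E"
      unfolding eventually_at_top_linorder using close near by (meson less_imp_le)
  qed simp
  then show ?thesis using \<open>e \<in> E\<close> tendsto_dist_iff by blast
qed

section \<open>Memristors\<close>

lemma memristor_nondecreasing:
  assumes "memristor_assumption Q Gm \<Phi>" "s \<le> t"
  shows "Q s \<le> Q t"
  using assms unfolding memristor_assumption_def
  by (metis DERIV_nonneg_imp_nondecreasing)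

lemma memristor_continuous:
  assumes "memristor_assumption Q Gm \<Phi>"
  shows "continuous_on S Q"
  using assms unfolding memristor_assumption_def
  by (meson DERIV_isCont continuous_at_imp_continuous_on)

text \<open>\<open>F s + K * s\<close> is nondecreasing for nonnegative \<open>s\<close>, and
  \<open>F s - K * s\<close> is nonincreasing for nonpositive \<open>s\<close>. Only one-sided
  bounds on \<open>p\<close> enter, because a memristor charge may grow faster than
  linearly.\<close>

lemma potential_lower_bound:
  fixes F p :: "real \<Rightarrow> real"
  assumes F: "\<And>s. (F has_real_derivative p s) (at s)"
    and pos: "\<And>s. 0 \<le> s \<Longrightarrow> - K \<le> p s" and neg: "\<And>s. s \<le> 0 \<Longrightarrow> p s \<le> K"
  shows "F 0 - K * \<bar>s\<bar> \<le> F s"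
proof (cases "0 \<le> s")
  case True
  have "F 0 + K * 0 \<le> F s + K * s"
  proof (rule DERIV_nonneg_imp_nondecreasing[where f = "\<lambda>s. F s + K * s", OF True])
    show "\<exists>y. ((\<lambda>s. F s + K * s) has_real_derivative y) (at t) \<and> 0 \<le> y" if "0 \<le> t" for t
      by (rule exI[of _ "p t + K"]) (use pos[OF that] in \<open>auto intro!: derivative_eq_intros F\<close>)
  qed
  then show ?thesis using True by simp
next
  case False
  have "F s - K * s \<ge> F 0 - K * 0"
  proof (rule DERIV_nonpos_imp_nonincreasing[where f = "\<lambda>s. F s - K * s"])
    show "\<exists>y. ((\<lambda>s. F s - K * s) has_real_derivative y) (at t) \<and> y \<le> 0" if "t \<le> 0" for t
      by (rule exI[of _ "p t - K"]) (use neg[OF that] in \<open>auto intro!: derivative_eq_intros F\<close>)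
  qed (use False in simp)
  then show ?thesis using False by simp
qed

text \<open>Subtracting \<open>Gm * s\<close> from the shifted charge leaves a function that is at
  least \<open>- K\<close> on the right of 0 and at most \<open>K\<close> on the left. Integrating
  this gives quadratic growth up to a linear loss.\<close>

lemma memristor_potential:
  assumes mem: "memristor_assumption Q Gm \<Phi>"
  obtains P K where "\<And>s. (P has_real_derivative Q (s + \<Phi>0) - Q \<Phi>0) (at s)"
    and "K \<ge> 0" "\<And>s. Gm / 2 * s\<^sup>2 - K * \<bar>s\<bar> \<le> P s"
proof -
  have Gm: "Gm > 0" and "\<Phi> > 0" and Q0: "Q 0 = 0"
    and slope: "\<And>s. \<bar>s\<bar> > \<Phi> \<Longrightarrow> Gm \<le> Q s / s"
    using mem by (auto simp: memristor_assumption_def)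
  note mono = memristor_nondecreasing[OF mem]
  have GP: "0 \<le> Gm * \<Phi>" using Gm \<open>\<Phi> > 0\<close> by simp
  \<comment> \<open>Beyond the threshold this is the slope bound. Below it the left-hand side is at
    most 0, and \<open>Q s\<close> is nonnegative by monotonicity.\<close>
  have right: "Gm * s - Gm * \<Phi> \<le> Q s" if "0 \<le> s" for s
  proof (cases "s > \<Phi>")
    case True
    then have "Gm * s \<le> Q s" using slope[of s] \<open>\<Phi> > 0\<close> by (simp add: pos_le_divide_eq)
    then show ?thesis using GP by simp
  next
    case False
    then have "Gm * s \<le> Gm * \<Phi>" using Gm by (intro mult_left_mono) auto
    then show ?thesis using mono[OF that] Q0 by simp
  qed
  have left: "Q s \<le> Gm * s + Gm * \<Phi>" if "s \<le> 0" for s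
  proof (cases "s < - \<Phi>")
    case True
    then have "Q s \<le> Gm * s" using slope[of s] \<open>\<Phi> > 0\<close> by (simp add: neg_le_divide_eq)
    then show ?thesis using GP by simp
  next
    case False
    then have "Gm * (- \<Phi>) \<le> Gm * s" using Gm by (intro mult_left_mono) auto
    then show ?thesis using mono[OF that] Q0 by simp
  qed
  \<comment> \<open>The three terms pay for the region below the threshold, for the shift of the
    argument by \<open>\<Phi>0\<close>, and for the subtracted constant
    \<open>Q \<Phi>0\<close>.\<close>
  define K where "K = Gm * \<Phi> + Gm * \<bar>\<Phi>0\<bar> + \<bar>Q \<Phi>0\<bar>"
  have K: "0 \<le> K" using GP Gm by (simp add: K_def)
  have \<Phi>0: "Gm * \<Phi>0 \<le> Gm * \<bar>\<Phi>0\<bar>" "- (Gm * \<bar>\<Phi>0\<bar>) \<le> Gm * \<Phi>0" "0 \<le> Gm * \<bar>\<Phi>0\<bar>"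
    using Gm by (auto simp: abs_if)
  have pos: "- K \<le> Q (s + \<Phi>0) - Q \<Phi>0 - Gm * s" if "0 \<le> s" for s
  proof (cases "0 \<le> s + \<Phi>0")
    case True
    from right[OF True] \<Phi>0 show ?thesis by (simp add: K_def algebra_simps)
  next
    \<comment> \<open>Here \<open>s\<close> lies between 0 and \<open>- \<Phi>0\<close>, so
      \<open>Gm * s\<close> is bounded and monotonicity controls the rest.\<close>
    case False
    then have "Gm * s \<le> Gm * \<bar>\<Phi>0\<bar>" using Gm by (intro mult_left_mono) auto
    then show ?thesis using mono[of \<Phi>0 "s + \<Phi>0"] that GP by (simp add: K_def)
  qed
  have neg: "Q (s + \<Phi>0) - Q \<Phi>0 - Gm * s \<le> K" if "s \<le> 0" for s
  proof (cases "s + \<Phi>0 \<le> 0")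
    case True
    from left[OF True] \<Phi>0 show ?thesis by (simp add: K_def algebra_simps)
  next
    case False
    then have "Gm * (- \<bar>\<Phi>0\<bar>) \<le> Gm * s" using Gm by (intro mult_left_mono) auto
    then show ?thesis using mono[of "s + \<Phi>0" \<Phi>0] that GP by (simp add: K_def)
  qed
  have "continuous_on UNIV (\<lambda>s. Q (s + \<Phi>0) - Q \<Phi>0)"
    by (intro continuous_intros continuous_on_compose2[OF memristor_continuous[OF mem, of UNIV]]) auto
  \<comment> \<open>Infinite end points give an antiderivative on the whole real line.\<close>
  then have "\<exists>P. \<forall>s. - \<infinity> < ereal s \<longrightarrow> ereal s < \<infinity> \<longrightarrow>
      (P has_vector_derivative Q (s + \<Phi>0) - Q \<Phi>0) (at s)"
    by (intro einterval_antiderivative) (auto simp: continuous_on_eq_continuous_at)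
  then obtain P where P: "\<And>s. (P has_real_derivative Q (s + \<Phi>0) - Q \<Phi>0) (at s)"
    by (auto simp: has_real_derivative_iff_has_vector_derivative)
  show thesis
  \<comment> \<open>Normalising the potential to vanish at 0 removes the constant from its lower
    bound.\<close>
  proof (rule that[of "\<lambda>s. P s - P 0", OF _ K])
    show "((\<lambda>s. P s - P 0) has_real_derivative Q (s + \<Phi>0) - Q \<Phi>0) (at s)" for s
      by (auto intro!: derivative_eq_intros P)
    have "(\<lambda>s. P s - P 0 - Gm / 2 * s\<^sup>2) 0 - K * \<bar>s\<bar> \<le> P s - P 0 - Gm / 2 * s\<^sup>2" for s
      by (rule potential_lower_bound[OF _ pos neg]) (auto intro!: derivative_eq_intros P)
    then show "Gm / 2 * s\<^sup>2 - K * \<bar>s\<bar> \<le> P s - P 0" for s by (simp add: algebra_simps)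
  qed
qed

section \<open>Brayton-Moser equations\<close>

text \<open>Self-adjointness of \<open>N\<close> makes the two terms of the product rule equal,
  which cancels the factor 1/2.\<close>

lemma quadratic_form_has_derivative:
  fixes N :: "real^'n::finite^'n" and h :: "'x::real_normed_vector \<Rightarrow> real^'n"
  assumes "(h has_derivative h') (at z)" "\<And>w w'. (N *v w) \<bullet> w' = w \<bullet> (N *v w')"
  shows "((\<lambda>z. h z \<bullet> (N *v h z) / 2) has_derivative (\<lambda>v. (N *v h z) \<bullet> h' v)) (at z)"
proof -
  have "((\<lambda>z. N *v h z) has_derivative (\<lambda>v. N *v h' v)) (at z)"
    by (rule bounded_linear.has_derivative[OF matrix_vector_mul_bounded_linear assms(1)])
  from has_derivative_inner[OF assms(1) this]
  have "((\<lambda>z. h z \<bullet> (N *v h z) / 2) has_derivative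
      (\<lambda>v. (h z \<bullet> (N *v h' v) + h' v \<bullet> (N *v h z)) / 2)) (at z)"
    by (rule bounded_linear.has_derivative[OF bounded_linear_divide])
  moreover have "(h z \<bullet> (N *v h' v) + h' v \<bullet> (N *v h z)) / 2 = (N *v h z) \<bullet> h' v" for v
    using assms(2)[of "h z" "h' v"] by (simp add: inner_commute)
  ultimately show ?thesis by simp
qed

text \<open>An abstract form of the state equations: \<open>A\<close>, \<open>B\<close>,
  \<open>D\<close> stand for the blocks of \<open>H\<close>, \<open>g\<close> for the memristor
  charge with potential \<open>F\<close>, and \<open>a\<close>, \<open>b\<close> for the constant
  terms. \<open>coercive\<close> concerns the part of the potential that remains after eliminating
  \<open>q\<close>, whose quadratic part contains the Schur complement of \<open>D\<close>.\<close>

locale brayton_moser =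
  fixes A :: "real^'c::finite^'c" and B :: "real^'l::finite^'c" and D :: "real^'l^'l"
    and C :: "'c \<Rightarrow> real" and L :: "'l \<Rightarrow> real"
    and F :: "real^'c \<Rightarrow> real" and g :: "real^'c \<Rightarrow> real^'c"
    and a :: "real^'c" and b :: "real^'l" and c k :: real
  assumes A: "transpose A = A" and D: "positive_definite D"
    and C: "\<And>i. C i > 0" and L: "\<And>l. L l > 0"
    and F: "\<And>\<phi>. (F has_derivative (\<lambda>h. g \<phi> \<bullet> h)) (at \<phi>)"
    and g: "continuous_on UNIV g"
    and c: "c > 0" and k: "k \<ge> 0"
    and coercive: "\<And>\<phi>. c * (norm \<phi>)\<^sup>2 - k * norm \<phi>
      \<le> F \<phi> + \<phi> \<bullet> (A *v \<phi>) / 2 + (transpose B *v \<phi>) \<bullet> (matrix_inv D *v (transpose B *v \<phi>)) / 2"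
    and norm_less: "spectral_norm (diagonal_matrix (\<lambda>l. sqrt (L l)) ** matrix_inv D ** transpose B **
       matrix_inv (diagonal_matrix (\<lambda>i. sqrt (C i)))) < 1"
begin

text \<open>The equation \<open>y z = 0\<close> is solved for \<open>snd z\<close> by
  \<open>matrix_inv D *v u (fst z)\<close>; this is the centre of the completed square.\<close>

definition u :: "real^'c \<Rightarrow> real^'l" where
  "u \<phi> = transpose B *v \<phi> + b"

definition y :: "(real^'c) \<times> (real^'l) \<Rightarrow> real^'l" where
  "y z = u (fst z) - D *v snd z"

definition field :: "(real^'c) \<times> (real^'l) \<Rightarrow> (real^'c) \<times> (real^'l)" where
  "field z = (diagonal_matrix (\<lambda>i. 1 / C i) *v (a - A *v fst z - B *v snd z - g (fst z)),
    diagonal_matrix (\<lambda>l. 1 / L l) *v y z)"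

text \<open>This is \<open>P + y \<bullet> (D\<^sup>-\<^sup>1 y)\<close> with the square in \<open>q\<close> completed.\<close>

definition W :: "(real^'c) \<times> (real^'l) \<Rightarrow> real" where
  "W z = F (fst z) + fst z \<bullet> (A *v fst z) / 2 - a \<bullet> fst z
    + u (fst z) \<bullet> (matrix_inv D *v u (fst z)) / 2 + y z \<bullet> (matrix_inv D *v y z) / 2"

definition dW :: "(real^'c) \<times> (real^'l) \<Rightarrow> (real^'c) \<times> (real^'l) \<Rightarrow> real" where
  "dW z v = (A *v fst z + g (fst z) - a) \<bullet> fst v
    + (matrix_inv D *v u (fst z)) \<bullet> (transpose B *v fst v)
    + (matrix_inv D *v y z) \<bullet> (transpose B *v fst v - D *v snd v)"

section \<open>The derivative of \<open>W\<close> and its sign along solutions\<close>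

lemma D_inverse: "D *v (matrix_inv D *v w) = w" "matrix_inv D *v (D *v w) = w"
  using positive_definite_inverse[OF D] by simp_all

lemma inverse_D_inner: "(matrix_inv D *v w) \<bullet> w' = w \<bullet> (matrix_inv D *v w')"
  using positive_definite_inverse(3)[OF D]
  by (intro symmetric_mult_inner) (simp add: positive_definite_def)

lemma W_has_derivative: "(W has_derivative dW z) (at z)"
proof -
  note lin = bounded_linear.has_derivative[OF matrix_vector_mul_bounded_linear]
  have fst: "(fst has_derivative fst) (at z)" and snd: "(snd has_derivative snd) (at z)"
    by (auto intro: bounded_linear_imp_has_derivative bounded_linear_fst bounded_linear_snd)
  have u: "((\<lambda>z. u (fst z)) has_derivative (\<lambda>v. transpose B *v fst v)) (at z)"
    unfolding u_def using has_derivative_add[OF lin[OF fst, of "transpose B"] has_derivative_const] by simp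
  have y: "(y has_derivative (\<lambda>v. transpose B *v fst v - D *v snd v)) (at z)"
    unfolding y_def[abs_def] by (rule has_derivative_diff[OF u lin[OF snd]])
  have F': "((\<lambda>z. F (fst z)) has_derivative (\<lambda>v. g (fst z) \<bullet> fst v)) (at z)"
    using has_derivative_compose[OF fst F] by simp
  have "(W has_derivative (\<lambda>v. g (fst z) \<bullet> fst v + (A *v fst z) \<bullet> fst v - a \<bullet> fst v
      + (matrix_inv D *v u (fst z)) \<bullet> (transpose B *v fst v)
      + (matrix_inv D *v y z) \<bullet> (transpose B *v fst v - D *v snd v))) (at z)"
    unfolding W_def[abs_def]
    by (intro has_derivative_add has_derivative_diff quadratic_form_has_derivative F' u y fst
        bounded_linear.has_derivative[OF bounded_linear_inner_right]
        inverse_D_inner symmetric_mult_inner A)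
  then show ?thesis
    by (rule has_derivative_eq_rhs) (simp add: dW_def fun_eq_iff inner_add_left inner_diff_left)
qed

lemma W_along_curve:
  assumes "(x has_vector_derivative v) (at t within S)"
  shows "((\<lambda>t. W (x t)) has_real_derivative dW (x t) v) (at t within S)"
proof -
  have "((\<lambda>t. W (x t)) has_derivative (\<lambda>h. dW (x t) (h *\<^sub>R v))) (at t within S)"
    using has_derivative_compose[OF _ W_has_derivative] assms by (simp add: has_vector_derivative_def)
  moreover have "dW (x t) (h *\<^sub>R v) = dW (x t) v * h" for h
    using linear_scale[OF has_derivative_linear[OF W_has_derivative]] by simp
  ultimately show ?thesis by (simp add: has_field_derivative_def)
qed

lemma continuous_field: "continuous_on UNIV field"
  unfolding field_def[abs_def] y_def u_def
  by (intro continuous_intros continuous_on_compose2[OF g]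
      matrix_vector_mult_linear_continuous_on
      linear_continuous_on_compose[OF _ matrix_vector_mul_linear]) auto

text \<open>In the norms weighted by the square roots of \<open>C\<close> and \<open>L\<close>, the
  cross term is at most \<kappa> times the sum of squares, with \<kappa> < 1 the spectral norm. A
  fraction 1 - \<kappa> of the dissipation remains.\<close>

lemma dissipation:
  obtains \<delta> where "\<delta> > 0" "\<And>z. dW z (field z) \<le> - \<delta> * (norm (field z))\<^sup>2"
proof -
  define N where "N = diagonal_matrix (\<lambda>l. sqrt (L l)) ** matrix_inv D ** transpose B **
       matrix_inv (diagonal_matrix (\<lambda>i. sqrt (C i)))"
  define \<kappa> where "\<kappa> = spectral_norm N"
  have \<kappa>: "0 \<le> \<kappa>" "\<kappa> < 1" "\<And>v. norm (N *v v) \<le> \<kappa> * norm v"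
    using norm_less onorm[OF matrix_vector_mul_bounded_linear, of N]
      onorm_pos_le[OF matrix_vector_mul_bounded_linear, of N]
    by (auto simp: \<kappa>_def N_def spectral_norm_def)
  let ?sC = "\<lambda>p. diagonal_matrix (\<lambda>i. sqrt (C i)) *v p"
  let ?sL = "\<lambda>p. diagonal_matrix (\<lambda>i. sqrt (L i)) *v p"
  \<comment> \<open>The smallest capacitance or inductance, which converts the weighted norms back
    to the ordinary one.\<close>
  define m where "m = min (Min (range C)) (Min (range L))"
  have m: "m > 0" "\<And>i. m \<le> C i" "\<And>l. m \<le> L l"
    using C L by (auto simp: m_def min_le_iff_disj)
  have N: "N *v ?sC p = ?sL (matrix_inv D *v (transpose B *v p))" for p
  proof -
    have "matrix_inv (diagonal_matrix (\<lambda>i. sqrt (C i))) *v ?sC p = p"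
      using C by (subst matrix_inv_diagonal) (auto simp: diagonal_matrix_mult_vector vec_eq_iff less_imp_neq[THEN not_sym])
    then show ?thesis by (simp add: N_def matrix_vector_mul_assoc[symmetric])
  qed
  have "dW z (field z) \<le> - ((1 - \<kappa>) * m) * (norm (field z))\<^sup>2" for z
  proof -
    define p r where "p = fst (field z)" and "r = snd (field z)"
    have Cp: "diagonal_matrix C *v p = a - A *v fst z - B *v snd z - g (fst z)"
      using C by (simp add: p_def field_def diagonal_matrix_mult_vector vec_eq_iff less_imp_neq[THEN not_sym])
    have Lr: "diagonal_matrix L *v r = y z"
      using L by (simp add: r_def field_def diagonal_matrix_mult_vector vec_eq_iff less_imp_neq[THEN not_sym])
    have sC: "(norm (?sC p))\<^sup>2 = (diagonal_matrix C *v p) \<bullet> p"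
      and sL: "(norm (?sL r))\<^sup>2 = (diagonal_matrix L *v r) \<bullet> r"
      and sL': "?sL r \<bullet> ?sL w = (diagonal_matrix L *v r) \<bullet> w" for w
      using C L by (auto simp: power2_norm_eq_inner diagonal_matrix_mult_vector inner_vec_def
          less_imp_le algebra_simps intro!: sum.cong simp flip: power2_eq_square)
    have mC: "m * (norm p)\<^sup>2 \<le> (norm (?sC p))\<^sup>2" and mL: "m * (norm r)\<^sup>2 \<le> (norm (?sL r))\<^sup>2"
      unfolding sC sL using m
      by (auto simp: power2_norm_eq_inner diagonal_matrix_mult_vector inner_vec_def sum_distrib_left
          mult.assoc intro!: sum_mono mult_right_mono)
    \<comment> \<open>With this substitution the terms containing \<open>snd z\<close> cancel, and
      the two remaining mixed terms in \<open>p\<close> are equal.\<close>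
    have Ku: "matrix_inv D *v u (fst z) = matrix_inv D *v y z + snd z"
      using D_inverse(2)[of "snd z"] by (simp add: y_def matrix_vector_mult_diff_distrib)
    have Bp: "(B *v s) \<bullet> p = s \<bullet> (transpose B *v p)" for s
      by (metis inner_commute transpose_mult_inner)
    have "dW z (field z) = - ((diagonal_matrix C *v p) \<bullet> p) - (B *v snd z) \<bullet> p
        + (matrix_inv D *v y z + snd z) \<bullet> (transpose B *v p)
        + (matrix_inv D *v y z) \<bullet> (transpose B *v p) - y z \<bullet> r"
      unfolding dW_def Ku Cp p_def[symmetric] r_def[symmetric]
      by (simp add: inner_diff_left inner_add_left inner_diff_right inverse_D_inner D_inverse)
    also have "\<dots> = - (norm (?sC p))\<^sup>2 - (norm (?sL r))\<^sup>2 + 2 * (?sL r \<bullet> (N *v ?sC p))"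
      unfolding sC sL N sL' Lr
      by (simp add: inner_add_left inverse_D_inner Bp)
    also have "?sL r \<bullet> (N *v ?sC p) \<le> norm (?sL r) * (\<kappa> * norm (?sC p))"
      by (rule order_trans[OF norm_cauchy_schwarz]) (simp add: \<kappa>(3) mult_left_mono)
    \<comment> \<open>The inequality 2ab \<le> a^2 + b^2 for the two weighted norms.\<close>
    also have "2 * (norm (?sL r) * (\<kappa> * norm (?sC p))) \<le> \<kappa> * ((norm (?sC p))\<^sup>2 + (norm (?sL r))\<^sup>2)"
      using mult_left_mono[OF sum_squares_bound[of "norm (?sL r)" "norm (?sC p)"] \<kappa>(1)]
      by (simp add: algebra_simps)
    finally have "dW z (field z) \<le> - ((1 - \<kappa>) * ((norm (?sC p))\<^sup>2 + (norm (?sL r))\<^sup>2))"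
      by (simp add: algebra_simps)
    also have "\<dots> \<le> - ((1 - \<kappa>) * (m * (norm p)\<^sup>2 + m * (norm r)\<^sup>2))"
      using \<kappa>(2) mC mL by (simp add: mult_left_mono)
    also have "m * (norm p)\<^sup>2 + m * (norm r)\<^sup>2 = m * (norm (field z))\<^sup>2"
      by (simp add: norm_prod_def p_def r_def algebra_simps)
    finally show ?thesis by (simp add: mult.assoc)
  qed
  moreover have "(1 - \<kappa>) * m > 0" using \<kappa>(2) m(1) by simp
  ultimately show thesis using that by blast
qed

section \<open>Coercivity of \<open>W\<close>\<close>

lemma W_lower_bound:
  obtains d k' where "d > 0" "k' \<ge> 0"
    "\<And>z. c * (norm (fst z))\<^sup>2 - k' * norm (fst z) + d * (norm (y z))\<^sup>2 \<le> W z"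
proof -
  have K: "\<And>w. w \<noteq> 0 \<Longrightarrow> w \<bullet> (matrix_inv D *v w) > 0"
    using positive_definite_inverse(3)[OF D] by (simp add: positive_definite_def)
  obtain d where d: "d > 0" "\<And>w. d * (norm w)\<^sup>2 \<le> w \<bullet> (matrix_inv D *v w)"
    using positive_form_coercive[OF K] by blast
  \<comment> \<open>The shift \<open>b\<close> in \<open>u\<close> adds to the quadratic form twice
    the inner product of \<phi> with \<open>w\<close>, together with a nonnegative constant.\<close>
  define w where "w = B *v (matrix_inv D *v b)"
  define k' where "k' = k + norm a + norm w"
  have "c * (norm (fst z))\<^sup>2 - k' * norm (fst z) + d / 2 * (norm (y z))\<^sup>2 \<le> W z" for z
  proof -
    let ?\<phi> = "fst z" and ?v = "transpose B *v fst z"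
    have "u ?\<phi> \<bullet> (matrix_inv D *v u ?\<phi>)
        = ?v \<bullet> (matrix_inv D *v ?v) + 2 * (?v \<bullet> (matrix_inv D *v b)) + b \<bullet> (matrix_inv D *v b)"
      using inverse_D_inner[of b ?v]
      by (simp add: u_def inner_add_left inner_add_right matrix_vector_right_distrib inner_commute)
    moreover have "?v \<bullet> (matrix_inv D *v b) = ?\<phi> \<bullet> w"
      by (simp add: transpose_mult_inner w_def)
    moreover have "- (norm w * norm ?\<phi>) \<le> ?\<phi> \<bullet> w"
      using Cauchy_Schwarz_ineq2[of ?\<phi> w] by (simp add: mult.commute)
    moreover have "a \<bullet> ?\<phi> \<le> norm a * norm ?\<phi>" by (rule norm_cauchy_schwarz)
    moreover have "0 \<le> b \<bullet> (matrix_inv D *v b)"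
      using K[of b] by (cases "b = 0") auto
    moreover have "k' * norm ?\<phi> = k * norm ?\<phi> + norm a * norm ?\<phi> + norm w * norm ?\<phi>"
      by (simp add: k'_def algebra_simps)
    ultimately show ?thesis
      using coercive[of ?\<phi>] d(2)[of "y z"] unfolding W_def by linarith
  qed
  moreover have "k' \<ge> 0" using k by (simp add: k'_def)
  ultimately show thesis using that[of "d / 2" k'] d(1) by simp
qed

text \<open>Since \<open>D\<close> is invertible, \<open>fst z\<close> and \<open>y z\<close> serve
  as coordinates in place of \<open>fst z\<close> and \<open>snd z\<close>. The lower bound on
  \<open>W\<close> confines them to a product of balls, and the change of coordinates back is
  continuous.\<close>

lemma bounded_sublevel: "bounded {z. W z \<le> r}"
proof -
  obtain d k' where d: "d > 0" and k': "k' \<ge> 0"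
    and W: "\<And>z. c * (norm (fst z))\<^sup>2 - k' * norm (fst z) + d * (norm (y z))\<^sup>2 \<le> W z"
    using W_lower_bound by blast
  define N1 where "N1 = (k' + \<bar>r\<bar>) / c + 1"
  define N2 where "N2 = (\<bar>r\<bar> + k' * N1) / d + 1"
  have "N1 \<ge> 1" using k' c by (simp add: N1_def)
  then have "N2 \<ge> 1" using k' d by (simp add: N2_def)
  let ?h = "\<lambda>(\<phi>, w). (\<phi>, matrix_inv D *v (u \<phi> - w))"
  have "continuous_on (cball 0 N1 \<times> cball 0 N2) ?h"
    unfolding u_def split_def
    by (intro continuous_intros linear_continuous_on_compose[OF _ matrix_vector_mul_linear])
  then have "compact (?h ` (cball 0 N1 \<times> cball 0 N2))"
    by (intro compact_continuous_image compact_Times compact_cball)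
  then have "bounded (?h ` (cball 0 N1 \<times> cball 0 N2))" by (rule compact_imp_bounded)
  moreover have "z \<in> ?h ` (cball 0 N1 \<times> cball 0 N2)" if "W z \<le> r" for z
  proof
    let ?n = "norm (fst z)"
    have le: "c * ?n\<^sup>2 - k' * ?n + d * (norm (y z))\<^sup>2 \<le> \<bar>r\<bar>" using W[of z] that by simp
    have n: "?n \<le> N1"
    proof (rule ccontr)
      assume "\<not> ?n \<le> N1"
      then have "?n > 1" "(k' + \<bar>r\<bar>) / c < ?n" using \<open>N1 \<ge> 1\<close> by (auto simp: N1_def)
      then have "?n > 1" "c * ?n > k' + \<bar>r\<bar>" using c by (simp_all add: pos_divide_less_eq mult.commute)
      then have "(c * ?n - k') * ?n > \<bar>r\<bar> * 1"
        by (intro mult_less_le_imp_less) auto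
      moreover have "0 \<le> d * (norm (y z))\<^sup>2" using d by simp
      ultimately show False using le by (simp add: power2_eq_square algebra_simps)
    qed
    moreover have "norm (y z) \<le> N2"
    proof (rule ccontr)
      assume big: "\<not> norm (y z) \<le> N2"
      then have "norm (y z) * 1 \<le> norm (y z) * norm (y z)"
        using \<open>N2 \<ge> 1\<close> by (intro mult_left_mono) auto
      then have "N2 - 1 < (norm (y z))\<^sup>2" using big by (simp add: power2_eq_square)
      then have "\<bar>r\<bar> + k' * N1 < d * (norm (y z))\<^sup>2"
        using d by (simp add: N2_def pos_divide_less_eq mult.commute)
      moreover have "k' * ?n \<le> k' * N1" using n k' by (simp add: mult_left_mono)
      moreover have "0 \<le> c * ?n\<^sup>2" using c by simp
      ultimately show False using le by simp
    qed
    ultimately show "(fst z, y z) \<in> cball 0 N1 \<times> cball 0 N2" by simp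
    show "z = ?h (fst z, y z)" by (simp add: y_def D_inverse)
  qed
  then have "{z. W z \<le> r} \<subseteq> ?h ` (cball 0 N1 \<times> cball 0 N2)" by blast
  ultimately show ?thesis by (rule bounded_subset)
qed

text \<open>The bound is the minimum of the quadratic polynomial in \<open>norm (fst z)\<close>,
  found by completing the square.\<close>

lemma W_bounded_below: "\<exists>m. \<forall>z. m \<le> W z"
proof -
  obtain d k' where d: "d > 0" and k': "k' \<ge> 0"
    and W: "\<And>z. c * (norm (fst z))\<^sup>2 - k' * norm (fst z) + d * (norm (y z))\<^sup>2 \<le> W z"
    using W_lower_bound by blast
  have "- (k'\<^sup>2 / (4 * c)) \<le> W z" for z
  proof -
    have "0 \<le> c * (norm (fst z) - k' / (2 * c))\<^sup>2" using c by simp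
    also have "\<dots> = c * (norm (fst z))\<^sup>2 - k' * norm (fst z) + k'\<^sup>2 / (4 * c)"
      using c by (simp add: power2_diff power_divide algebra_simps power2_eq_square)
    finally have "0 \<le> c * (norm (fst z))\<^sup>2 - k' * norm (fst z) + k'\<^sup>2 / (4 * c)" .
    moreover have "0 \<le> d * (norm (y z))\<^sup>2" using d by simp
    ultimately show ?thesis using W[of z] by linarith
  qed
  then show ?thesis by blast
qed

text \<open>\<open>W\<close> never exceeds its initial value, so the trajectory remains in one
  sublevel set. The conditions on \<open>J\<close> allow any interval of existence that starts at
  0.\<close>

theorem trajectory_bounded:
  assumes J: "\<And>t. t \<in> J \<Longrightarrow> 0 \<le> t" "\<And>t. t \<in> J \<Longrightarrow> {0..t} \<subseteq> J"
    and x: "\<And>t. t \<in> J \<Longrightarrow> (x has_vector_derivative field (x t)) (at t within J)"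
  shows "bounded (x ` J)"
proof -
  obtain \<delta> where \<delta>: "\<delta> > 0" "\<And>z. dW z (field z) \<le> - \<delta> * (norm (field z))\<^sup>2"
    using dissipation by blast
  have "W (x t) \<le> W (x 0)" if t: "t \<in> J" for t
  proof -
    have t0: "0 \<le> t" using J(1)[OF t] .
    have "\<exists>s\<in>{0..t}. W (x t) - W (x 0) = dW (x s) (field (x s)) * (t - 0)"
    proof (rule mvt_very_simple[OF t0])
      fix s assume "0 \<le> s" "s \<le> t"
      then have "s \<in> J" using J(2)[OF t] by auto
      then have "((\<lambda>t. W (x t)) has_real_derivative dW (x s) (field (x s))) (at s within {0..t})"
        using W_along_curve[OF x] J(2)[OF t] DERIV_subset by blast
      then show "((\<lambda>t. W (x t)) has_derivative (\<lambda>h. dW (x s) (field (x s)) * h)) (at s within {0..t})"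
        by (simp add: has_field_derivative_def)
    qed
    then obtain s where "W (x t) - W (x 0) = dW (x s) (field (x s)) * t" by auto
    moreover have "dW (x s) (field (x s)) \<le> 0"
      using \<delta>(2)[of "x s"] \<delta>(1) by (smt (verit) mult_nonneg_nonneg mult_minus_left zero_le_power2)
    ultimately show ?thesis using t0 mult_nonpos_nonneg[of "dW (x s) (field (x s))" t] by linarith
  qed
  then have "x ` J \<subseteq> {z. W z \<le> W (x 0)}" by blast
  with bounded_sublevel show ?thesis by (rule bounded_subset)
qed

theorem trajectory_convergent:
  assumes x: "\<And>t. 0 \<le> t \<Longrightarrow> (x has_vector_derivative field (x t)) (at t within {0..})"
  shows "converges_to_set x {z. field z = 0}"
    and "(\<forall>e\<in>{z. field z = 0}. e isolated_in {z. field z = 0}) \<Longrightarrow>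
      (\<exists>e\<in>{z. field z = 0}. (x \<longlongrightarrow> e) at_top)"
proof -
  have bdd: "bounded (x ` {0..})"
    by (rule trajectory_bounded) (use x in auto)
  obtain \<delta> where \<delta>: "\<delta> > 0" "\<And>z. dW z (field z) \<le> - \<delta> * (norm (field z))\<^sup>2"
    using dissipation by blast
  obtain m where m: "\<And>z. m \<le> W z" using W_bounded_below by blast
  have "((\<lambda>t. field (x t)) \<longlongrightarrow> 0) at_top"
    by (rule dissipation_imp_velocity_vanishes[OF continuous_field x bdd W_along_curve[OF x] \<delta> m])
  then show conv: "converges_to_set x {z. field z = 0}"
    by (rule velocity_vanishes_imp_converges_to_set[OF continuous_field _ bdd])
  have "continuous_on {0..} x"
    using x by (meson atLeast_iff continuous_on_eq_continuous_within has_vector_derivative_continuous)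
  moreover have "closed {z. field z = 0}"
    by (intro closed_Collect_eq continuous_field continuous_on_const)
  ultimately show "(\<forall>e\<in>{z. field z = 0}. e isolated_in {z. field z = 0}) \<Longrightarrow>
      (\<exists>e\<in>{z. field z = 0}. (x \<longlongrightarrow> e) at_top)"
    by (intro converges_to_isolated_set_imp_tendsto[OF conv _ bdd]) auto
qed

end

section \<open>The reduced capacitive conductance form\<close>

text \<open>The inverse of the diagonal matrix \<open>R_cotree\<close> is diagonal; the padding by 1
  keeps its diagonal free of zeros.\<close>

lemma transpose_H_aa:
  assumes "is_circuit G C L R"
  shows "transpose (H_aa G T R) = H_aa G T R"
proof -
  have "matrix_inv (R_cotree G T R)
      = diagonal_matrix (\<lambda>r. 1 / (if Res r \<in> arcs G - T then R r else 1))"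
    unfolding R_cotree_def using assms by (intro matrix_inv_diagonal) (auto simp: is_circuit_def)
  then show ?thesis
    by (simp add: H_aa_def matrix_transpose_mul transpose_diagonal_matrix matrix_mul_assoc)
qed

text \<open>This writes the form as a sum over resistors of conductance times a square. Padding
  indices have weight 1, but their component of \<open>transpose (A_CR G T) *v \<phi>\<close> is
  0.\<close>

lemma H_aa_form:
  assumes "is_circuit G C L R"
  shows "\<phi> \<bullet> (H_aa G T R *v \<phi>) =
    (\<Sum>r\<in>UNIV. 1 / (if Res r \<in> arcs G - T then R r else 1) * ((transpose (A_CR G T) *v \<phi>) $ r)\<^sup>2)"
proof -
  have "matrix_inv (R_cotree G T R)
      = diagonal_matrix (\<lambda>r. 1 / (if Res r \<in> arcs G - T then R r else 1))"
    unfolding R_cotree_def using assms by (intro matrix_inv_diagonal) (auto simp: is_circuit_def)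
  then have "\<phi> \<bullet> (H_aa G T R *v \<phi>) = (transpose (A_CR G T) *v \<phi>) \<bullet>
      (diagonal_matrix (\<lambda>r. 1 / (if Res r \<in> arcs G - T then R r else 1)) *v
        (transpose (A_CR G T) *v \<phi>))"
    by (simp add: H_aa_def matrix_vector_mul_assoc[symmetric] transpose_mult_inner)
  then show ?thesis
    by (simp add: diagonal_matrix_mult_vector inner_vec_def power2_eq_square mult_ac)
qed

lemma A_CR_non_cotree: "Res r \<notin> arcs G - T \<Longrightarrow> (transpose (A_CR G T) *v \<phi>) $ r = 0"
  by (simp add: matrix_vector_mult_def transpose_def A_CR_def del: Diff_iff)

text \<open>The tree branch \<open>Cap j\<close> joins the ends of \<open>Res r\<close>, so
  \<open>Res r\<close> can cross only the cut-set of \<open>Cap j\<close>. Its column in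
  \<open>A_CR\<close> is thus zero outside row \<open>j\<close>.\<close>

lemma A_CR_parallel_resistor:
  assumes "is_circuit G C L R" "range Cap \<subseteq> T" "parallel_branches G (Res r) (Cap j)"
  shows "\<bar>(transpose (A_CR G T) *v \<phi>) $ r\<bar> \<le> \<bar>\<phi> $ j\<bar>"
proof -
  have G: "wf_digraph G" "range Cap \<subseteq> arcs G"
    using assms(1) by (auto simp: is_circuit_def fin_digraph_def)
  have "A_CR G T $ i $ r * \<phi> $ i = (if i = j then A_CR G T $ j $ r * \<phi> $ j else 0)" for i
    using cutset_coeff_parallel_tree_branch[OF G(1), of "Cap j" T "Cap i" "Res r"] assms G(2)
    by (auto simp: A_CR_def)
  then have "(\<Sum>i\<in>UNIV. A_CR G T $ i $ r * \<phi> $ i)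
      = (\<Sum>i\<in>UNIV. if i = j then A_CR G T $ j $ r * \<phi> $ j else 0)"
    by (intro sum.cong refl)
  then have "(transpose (A_CR G T) *v \<phi>) $ r = A_CR G T $ j $ r * \<phi> $ j"
    by (simp add: matrix_vector_mult_def transpose_def)
  moreover have "\<bar>A_CR G T $ j $ r\<bar> \<le> 1" by (simp add: A_CR_def abs_cutset_coeff_le_1)
  ultimately show ?thesis by (simp add: abs_mult mult_left_le_one_le)
qed

text \<open>Each negative conductance is absorbed by the memristor assigned to it, with a positive
  surplus, so the form is at least a sum of nonnegative terms. If it were not positive, all these
  terms would vanish; then both transposed blocks would annihilate \<phi>, contrary to the rank
  condition.\<close>

lemma memristors_dominate_active_resistors:
  fixes G :: "('v, 'c::finite, 'l::finite, 'r::finite) circuit_graph" and K :: "real^'l^'l"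
  assumes circuit: "is_circuit G C L R" and tree: "range Cap \<subseteq> T"
    and Gm: "\<And>i. i \<in> M \<Longrightarrow> Gm i > 0"
    and inj: "inj_on m (active_resistors G R)"
    and active: "\<And>r. r \<in> active_resistors G R \<Longrightarrow>
      m r \<in> M \<and> parallel_branches G (Res r) (Cap (m r)) \<and> Gm (m r) > \<bar>1 / R r\<bar>"
    and full_rank: "rank (block_row (A_CL G T) (A_CR G T)) = CARD('c)"
    and K: "positive_definite K" and "\<phi> \<noteq> 0"
  shows "\<phi> \<bullet> ((H_aa G T R + A_CL G T ** K ** transpose (A_CL G T)
      + diagonal_matrix (\<lambda>i. if i \<in> M then Gm i else 0)) *v \<phi>) > 0"
proof (rule ccontr)
  assume neg: "\<not> ?thesis"
  define \<alpha> where "\<alpha> r = (transpose (A_CR G T) *v \<phi>) $ r" for r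
  define \<rho> where "\<rho> r = 1 / (if Res r \<in> arcs G - T then R r else 1)" for r
  define v where "v = transpose (A_CL G T) *v \<phi>"
  let ?Act = "active_resistors G R"
  have R: "\<And>r. Res r \<in> arcs G \<Longrightarrow> R r \<noteq> 0" using circuit by (simp add: is_circuit_def)
  have form: "\<phi> \<bullet> ((H_aa G T R + A_CL G T ** K ** transpose (A_CL G T)
      + diagonal_matrix (\<lambda>i. if i \<in> M then Gm i else 0)) *v \<phi>)
      = (\<Sum>r\<in>UNIV. \<rho> r * (\<alpha> r)\<^sup>2) + v \<bullet> (K *v v) + (\<Sum>i\<in>M. Gm i * (\<phi> $ i)\<^sup>2)"
  proof -
    have "\<phi> \<bullet> (diagonal_matrix (\<lambda>i. if i \<in> M then Gm i else 0) *v \<phi>)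
        = (\<Sum>i\<in>UNIV. if i \<in> M then Gm i * (\<phi> $ i)\<^sup>2 else 0)"
      unfolding diagonal_matrix_mult_vector inner_vec_def
      by (intro sum.cong) (auto simp: power2_eq_square)
    then have "\<phi> \<bullet> (diagonal_matrix (\<lambda>i. if i \<in> M then Gm i else 0) *v \<phi>)
        = (\<Sum>i\<in>M. Gm i * (\<phi> $ i)\<^sup>2)"
      by (simp add: sum.If_cases)
    moreover have "\<phi> \<bullet> ((A_CL G T ** K ** transpose (A_CL G T)) *v \<phi>) = v \<bullet> (K *v v)"
      by (simp add: v_def matrix_vector_mul_assoc[symmetric] transpose_mult_inner)
    ultimately show ?thesis
      by (simp add: matrix_vector_mult_add_rdistrib inner_add_right H_aa_form[OF circuit] \<alpha>_def \<rho>_def)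
  qed
  \<comment> \<open>Injectivity of \<open>m\<close> ensures that no memristor is spent on two active
    resistors.\<close>
  have "(\<Sum>r\<in>?Act. Gm (m r) * (\<phi> $ m r)\<^sup>2) = (\<Sum>i\<in>m ` ?Act. Gm i * (\<phi> $ i)\<^sup>2)"
    using inj by (simp add: sum.reindex)
  also have "\<dots> \<le> (\<Sum>i\<in>M. Gm i * (\<phi> $ i)\<^sup>2)"
    using active Gm by (intro sum_mono2) (auto simp: less_imp_le)
  finally have mem: "(\<Sum>r\<in>?Act. Gm (m r) * (\<phi> $ m r)\<^sup>2) \<le> (\<Sum>i\<in>M. Gm i * (\<phi> $ i)\<^sup>2)" .
  have act: "\<bar>\<alpha> r\<bar> \<le> \<bar>\<phi> $ m r\<bar>" if "r \<in> ?Act" for r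
    using A_CR_parallel_resistor[OF circuit tree] active[OF that] by (simp add: \<alpha>_def)
  have "- \<bar>1 / R r\<bar> * (\<phi> $ m r)\<^sup>2 \<le> \<rho> r * (\<alpha> r)\<^sup>2" if r: "r \<in> ?Act" for r
  proof (cases "Res r \<in> arcs G - T")
    case True
    have "(\<alpha> r)\<^sup>2 \<le> (\<phi> $ m r)\<^sup>2" using act[OF r] by (simp add: abs_le_square_iff)
    then have "\<bar>1 / R r\<bar> * (\<alpha> r)\<^sup>2 \<le> \<bar>1 / R r\<bar> * (\<phi> $ m r)\<^sup>2" by (intro mult_left_mono) auto
    moreover have "\<rho> r = - \<bar>1 / R r\<bar>" using True r by (simp add: \<rho>_def active_resistors_def)
    ultimately show ?thesis by simp
  next
    \<comment> \<open>The column of \<open>A_CR\<close> is zero here, and the left-hand side is at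
      most 0.\<close>
    case False
    then have "\<alpha> r = 0" by (simp add: \<alpha>_def A_CR_non_cotree)
    then show ?thesis by simp
  qed
  then have "(\<Sum>r\<in>?Act. - \<bar>1 / R r\<bar> * (\<phi> $ m r)\<^sup>2) \<le> (\<Sum>r\<in>?Act. \<rho> r * (\<alpha> r)\<^sup>2)"
    by (rule sum_mono)
  then have "(\<Sum>r\<in>?Act. (Gm (m r) - \<bar>1 / R r\<bar>) * (\<phi> $ m r)\<^sup>2)
      \<le> (\<Sum>r\<in>?Act. \<rho> r * (\<alpha> r)\<^sup>2) + (\<Sum>i\<in>M. Gm i * (\<phi> $ i)\<^sup>2)"
    using mem by (simp add: left_diff_distrib sum_subtractf sum_negf)
  moreover have "(\<Sum>r\<in>UNIV. \<rho> r * (\<alpha> r)\<^sup>2) = (\<Sum>r\<in>?Act. \<rho> r * (\<alpha> r)\<^sup>2) + (\<Sum>r\<in>-?Act. \<rho> r * (\<alpha> r)\<^sup>2)"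
    using sum.subset_diff[of ?Act UNIV "\<lambda>r. \<rho> r * (\<alpha> r)\<^sup>2"] by (simp add: Compl_eq_Diff_UNIV)
  ultimately have total: "(\<Sum>r\<in>?Act. (Gm (m r) - \<bar>1 / R r\<bar>) * (\<phi> $ m r)\<^sup>2)
      + (\<Sum>r\<in>-?Act. \<rho> r * (\<alpha> r)\<^sup>2) + v \<bullet> (K *v v) \<le> 0"
    using neg form by linarith
  have nn1: "0 \<le> (Gm (m r) - \<bar>1 / R r\<bar>) * (\<phi> $ m r)\<^sup>2" if "r \<in> ?Act" for r
    using active[OF that] by simp
  \<comment> \<open>Outside the active resistors the weight is a positive conductance or the padding
    value 1.\<close>
  have \<rho>: "\<rho> r > 0" if "r \<in> - ?Act" for r
    using that R[of r] by (auto simp: \<rho>_def active_resistors_def)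
  then have nn2: "0 \<le> \<rho> r * (\<alpha> r)\<^sup>2" if "r \<in> - ?Act" for r
    using that by (simp add: less_imp_le)
  have "0 \<le> v \<bullet> (K *v v)"
    using K by (cases "v = 0") (auto simp: positive_definite_def less_imp_le)
  moreover have "0 \<le> (\<Sum>r\<in>?Act. (Gm (m r) - \<bar>1 / R r\<bar>) * (\<phi> $ m r)\<^sup>2)"
    using nn1 by (rule sum_nonneg)
  moreover have "0 \<le> (\<Sum>r\<in>-?Act. \<rho> r * (\<alpha> r)\<^sup>2)"
    using nn2 by (rule sum_nonneg)
  ultimately have z: "(\<Sum>r\<in>?Act. (Gm (m r) - \<bar>1 / R r\<bar>) * (\<phi> $ m r)\<^sup>2) = 0"
    "(\<Sum>r\<in>-?Act. \<rho> r * (\<alpha> r)\<^sup>2) = 0" "v \<bullet> (K *v v) = 0"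
    using total by linarith+
  \<comment> \<open>For an active resistor the surplus forces its capacitor flux to be 0, and this
    bounds \<open>\<alpha> r\<close>. For the other indices the positive weight forces it
    directly.\<close>
  have "\<alpha> r = 0" for r
  proof (cases "r \<in> ?Act")
    case True
    then have "(Gm (m r) - \<bar>1 / R r\<bar>) * (\<phi> $ m r)\<^sup>2 = 0"
      using z(1) nn1 by (simp add: sum_nonneg_eq_0_iff)
    then have "\<phi> $ m r = 0" using active[OF True] by auto
    then show ?thesis using act[OF True] by simp
  next
    case False
    moreover have "\<forall>r\<in>-?Act. \<rho> r * (\<alpha> r)\<^sup>2 = 0"
      using z(2) by (simp only: sum_nonneg_eq_0_iff[OF finite nn2])
    ultimately have "\<rho> r * (\<alpha> r)\<^sup>2 = 0" by blast
    then show ?thesis using \<rho>[of r] False by simp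
  qed
  then have "transpose (A_CR G T) *v \<phi> = 0" by (simp add: \<alpha>_def vec_eq_iff)
  moreover have "transpose (A_CL G T) *v \<phi> = 0"
    using z(3) K by (auto simp: positive_definite_def v_def)
  ultimately show False using block_row_full_rank[OF full_rank] \<open>\<phi> \<noteq> 0\<close> by blast
qed

text \<open>The charge acts componentwise and is therefore the gradient of the sum of the scalar
  potentials. Their linear losses add up because each component of \<phi> is at most
  \<open>norm \<phi>\<close> in modulus.\<close>

lemma memristor_charge_potential:
  assumes "\<And>i. i \<in> M \<Longrightarrow> memristor_assumption (Q i) (Gm i) (\<Phi>thr i)"
  shows "\<exists>F k. (\<forall>\<phi>::real^'c::finite. (F has_derivative (\<lambda>h. memristor_charge M Q \<psi> \<phi> \<bullet> h)) (at \<phi>))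
    \<and> k \<ge> 0
    \<and> (\<forall>\<phi>. \<phi> \<bullet> (diagonal_matrix (\<lambda>i. if i \<in> M then Gm i else 0) *v \<phi>) / 2 - k * norm \<phi> \<le> F \<phi>)"
proof -
  \<comment> \<open>\<open>PK\<close> pairs the potential of one memristor with its loss constant,
    so that both are chosen together.\<close>
  have "\<forall>i\<in>M. \<exists>PK. (\<forall>s. (fst PK has_real_derivative Q i (s + \<psi> i) - Q i (\<psi> i)) (at s)) \<and>
      0 \<le> snd PK \<and> (\<forall>s. Gm i / 2 * s\<^sup>2 - snd PK * \<bar>s\<bar> \<le> fst PK s)"
    using memristor_potential[OF assms] by (metis fst_conv snd_conv)
  then obtain PK where PK: "\<And>i s. i \<in> M \<Longrightarrow> (fst (PK i) has_real_derivative Q i (s + \<psi> i) - Q i (\<psi> i)) (at s)"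
      "\<And>i. i \<in> M \<Longrightarrow> 0 \<le> snd (PK i)"
      "\<And>i s. i \<in> M \<Longrightarrow> Gm i / 2 * s\<^sup>2 - snd (PK i) * \<bar>s\<bar> \<le> fst (PK i) s"
    by (metis (no_types, lifting))
  show ?thesis
  proof (intro exI conjI allI)
    show "((\<lambda>\<phi>. \<Sum>i\<in>M. fst (PK i) (\<phi> $ i)) has_derivative (\<lambda>h. memristor_charge M Q \<psi> \<phi> \<bullet> h)) (at \<phi>)" for \<phi>
    proof -
      have "((\<lambda>\<phi>. \<Sum>i\<in>M. fst (PK i) (\<phi> $ i)) has_derivative
          (\<lambda>h. \<Sum>i\<in>M. (Q i (\<phi> $ i + \<psi> i) - Q i (\<psi> i)) * h $ i)) (at \<phi>)"
        by (intro has_derivative_sum has_derivative_compose[OF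
              bounded_linear_imp_has_derivative[OF bounded_linear_vec_nth]
              PK(1)[unfolded has_field_derivative_def]])
      moreover have "memristor_charge M Q \<psi> \<phi> \<bullet> h
          = (\<Sum>i\<in>M. (Q i (\<phi> $ i + \<psi> i) - Q i (\<psi> i)) * h $ i)" for h
        by (simp add: memristor_charge_def inner_vec_def if_distrib[of "\<lambda>x. x * _"] sum.If_cases
            cong: if_cong)
      ultimately show ?thesis by simp
    qed
    show "0 \<le> (\<Sum>i\<in>M. snd (PK i))" using PK(2) by (rule sum_nonneg)
    show "\<phi> \<bullet> (diagonal_matrix (\<lambda>i. if i \<in> M then Gm i else 0) *v \<phi>) / 2 - (\<Sum>i\<in>M. snd (PK i)) * norm \<phi>
        \<le> (\<Sum>i\<in>M. fst (PK i) (\<phi> $ i))" for \<phi> :: "real^'c"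
    proof -
      have "\<phi> \<bullet> (diagonal_matrix (\<lambda>i. if i \<in> M then Gm i else 0) *v \<phi>)
          = (\<Sum>i\<in>UNIV. if i \<in> M then Gm i * (\<phi> $ i)\<^sup>2 else 0)"
        unfolding diagonal_matrix_mult_vector inner_vec_def
        by (intro sum.cong) (auto simp: power2_eq_square)
      also have "\<dots> = (\<Sum>i\<in>M. Gm i * (\<phi> $ i)\<^sup>2)"
        by (simp add: sum.If_cases)
      finally have "\<phi> \<bullet> (diagonal_matrix (\<lambda>i. if i \<in> M then Gm i else 0) *v \<phi>) / 2 - (\<Sum>i\<in>M. snd (PK i)) * norm \<phi>
          = (\<Sum>i\<in>M. Gm i / 2 * (\<phi> $ i)\<^sup>2 - snd (PK i) * norm \<phi>)"
        by (simp add: sum_subtractf sum_distrib_right sum_divide_distrib)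
      also have "\<dots> \<le> (\<Sum>i\<in>M. fst (PK i) (\<phi> $ i))"
      proof (rule sum_mono)
        fix i assume i: "i \<in> M"
        have "snd (PK i) * \<bar>\<phi> $ i\<bar> \<le> snd (PK i) * norm \<phi>"
          using PK(2)[OF i] component_le_norm_cart by (intro mult_left_mono)
        then show "Gm i / 2 * (\<phi> $ i)\<^sup>2 - snd (PK i) * norm \<phi> \<le> fst (PK i) (\<phi> $ i)"
          using PK(3)[OF i, of "\<phi> $ i"] by simp
      qed
      finally show ?thesis .
    qed
  qed
qed

lemma continuous_memristor_charge:
  fixes M :: "'c::finite set"
  assumes "\<And>i. i \<in> M \<Longrightarrow> memristor_assumption (Q i) (Gm i) (\<Phi>thr i)"
  shows "continuous_on UNIV (memristor_charge M Q \<Phi>0)"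
proof -
  have "continuous_on UNIV (\<lambda>\<phi>::real^'c. if i \<in> M then Q i (\<phi> $ i + \<Phi>0 i) - Q i (\<Phi>0 i) else 0)" for i
    by (cases "i \<in> M") (auto intro!: continuous_intros
        continuous_on_compose2[OF memristor_continuous[OF assms, of i UNIV]])
  then show ?thesis unfolding memristor_charge_def by (intro continuous_on_vec_lambda)
qed

text \<open>The solution is taken on \<open>[0, tmax)\<close>, so boundedness also covers a finite
  interval of existence, while limits at infinity are stated for \<open>tmax = \<infinity>\<close>.
  The proof verifies the assumptions of \<open>brayton_moser\<close> and translates its field back
  to the block form.\<close>

theorem theorem5:
  fixes G :: "('v, 'c::finite, 'l::finite, 'r::finite) circuit_graph"
    and T :: "('c, 'l, 'r) branch set"
    and C :: "'c \<Rightarrow> real" and L :: "'l \<Rightarrow> real" and R :: "'r \<Rightarrow> real"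
    and M :: "'c set" and Q :: "'c \<Rightarrow> real \<Rightarrow> real" and Gm \<Phi>thr :: "'c \<Rightarrow> real"
    and v0 :: "real^'c" and i0 :: "real^'l" and \<Phi>0 :: "'c \<Rightarrow> real"
    and x :: "real \<Rightarrow> (real^'c) \<times> (real^'l)" and tmax :: ereal
  defines "J \<equiv> {t. 0 \<le> t \<and> ereal t < tmax}"
    and "H \<equiv> H_matrix G T R"
  defines "E \<equiv> equilibria H C L M Q \<Phi>0 v0 i0"
  assumes circuit: "is_circuit G C L R"
    and topology: "topological_assumption G T"
    and memristors: "\<And>i. i \<in> M \<Longrightarrow> memristor_assumption (Q i) (Gm i) (\<Phi>thr i)"
    and fewer_memristors: "card M < CARD('c)"
    and active: "\<exists>m. inj_on m (active_resistors G R) \<and>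
      (\<forall>r\<in>active_resistors G R. m r \<in> M \<and>
        parallel_branches G (Res r) (Cap (m r)) \<and> Gm (m r) > \<bar>1 / R r\<bar>)"
    and full_rank: "rank (block_row (A_CL G T) (A_CR G T)) = CARD('c)"
    and pos_def: "positive_definite (H_bb G T R)"
    and norm_less: "spectral_norm
      (diagonal_matrix (\<lambda>l. sqrt (L l)) ** matrix_inv (H_bb G T R) ** transpose (H_ab G T) **
       matrix_inv (diagonal_matrix (\<lambda>i. sqrt (C i)))) < 1"
    and tmax: "0 < tmax"
    and solution: "solves_state_equations H C L M Q \<Phi>0 v0 i0 x J"
  shows "bounded (x ` J) \<and>
    (tmax = \<infinity> \<longrightarrow> converges_to_set x E \<and>
      ((\<forall>e\<in>E. e isolated_in E) \<longrightarrow> (\<exists>e\<in>E. (x \<longlongrightarrow> e) at_top)))"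
proof -
  let ?A = "H_aa G T R" and ?B = "H_ab G T" and ?D = "H_bb G T R"
  let ?Gd = "diagonal_matrix (\<lambda>i. if i \<in> M then Gm i else 0)"
  have C: "\<And>i. C i > 0" and L: "\<And>l. L l > 0" using circuit by (auto simp: is_circuit_def)
  then have CL: "C i \<noteq> 0" "L l \<noteq> 0" for i l by (metis less_irrefl)+
  obtain m where m: "inj_on m (active_resistors G R)"
    "\<And>r. r \<in> active_resistors G R \<Longrightarrow>
      m r \<in> M \<and> parallel_branches G (Res r) (Cap (m r)) \<and> Gm (m r) > \<bar>1 / R r\<bar>"
    using active by blast
  have tree: "range Cap \<subseteq> T" using topology by (simp add: topological_assumption_def)
  have Gm: "\<And>i. i \<in> M \<Longrightarrow> Gm i > 0" using memristors by (auto simp: memristor_assumption_def)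
  have pot: "\<exists>F k. (\<forall>\<phi>. (F has_derivative (\<lambda>h. memristor_charge M Q \<Phi>0 \<phi> \<bullet> h)) (at \<phi>)) \<and> k \<ge> 0
      \<and> (\<forall>\<phi>. \<phi> \<bullet> (?Gd *v \<phi>) / 2 - k * norm \<phi> \<le> F \<phi>)"
    by (rule memristor_charge_potential) (rule memristors)
  obtain F k where F: "\<And>\<phi>. (F has_derivative (\<lambda>h. memristor_charge M Q \<Phi>0 \<phi> \<bullet> h)) (at \<phi>)"
    and k: "k \<ge> 0" and F_ge: "\<And>\<phi>. \<phi> \<bullet> (?Gd *v \<phi>) / 2 - k * norm \<phi> \<le> F \<phi>"
    using pot by blast
  have pos: "\<phi> \<bullet> ((?A + ?B ** matrix_inv ?D ** transpose ?B + ?Gd) *v \<phi>) > 0" if "\<phi> \<noteq> 0" for \<phi>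
    unfolding H_ab_def
    by (rule memristors_dominate_active_resistors[OF circuit tree _ m(1) m(2) full_rank
          positive_definite_inverse(3)[OF pos_def] that]) (rule Gm)
  obtain c where c: "c > 0"
    "\<And>\<phi>. c * (norm \<phi>)\<^sup>2 \<le> \<phi> \<bullet> ((?A + ?B ** matrix_inv ?D ** transpose ?B + ?Gd) *v \<phi>)"
    using positive_form_coercive[OF pos] by blast
  \<comment> \<open>The constant is \<open>c / 2\<close> because potentials carry half of the
    quadratic form; the memristor part of that form is taken over by \<open>F\<close>.\<close>
  interpret bm: brayton_moser ?A ?B ?D C L F "memristor_charge M Q \<Phi>0"
    "diagonal_matrix C *v v0" "diagonal_matrix L *v i0" "c / 2" k
  proof unfold_locales
    show "c / 2 * (norm \<phi>)\<^sup>2 - k * norm \<phi> \<le> F \<phi> + \<phi> \<bullet> (?A *v \<phi>) / 2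
        + (transpose ?B *v \<phi>) \<bullet> (matrix_inv ?D *v (transpose ?B *v \<phi>)) / 2" for \<phi>
      using c(2)[of \<phi>] F_ge[of \<phi>]
      by (simp add: matrix_vector_mult_add_rdistrib inner_add_right matrix_vector_mul_assoc[symmetric]
          transpose_mult_inner)
  qed (use C L F k c norm_less pos_def transpose_H_aa[OF circuit]
      continuous_memristor_charge[OF memristors] in auto)
  have rhs: "state_rhs H C L M Q \<Phi>0 v0 i0 z = block_vector (diagonal_matrix C *v fst (bm.field z))
      (diagonal_matrix L *v snd (bm.field z))" for z
  proof -
    have minus: "(- transpose ?B) *v w = - (transpose ?B *v w)" for w
      by (simp add: matrix_vector_mult_def vec_eq_iff sum_negf)
    have "state_rhs H C L M Q \<Phi>0 v0 i0 z = block_vector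
        (diagonal_matrix C *v v0 - ?A *v fst z - ?B *v snd z - memristor_charge M Q \<Phi>0 (fst z)) (bm.y z)"
      by (simp add: state_rhs_def split_def H_def H_matrix_def block_matrix_mult_block_vector
          block_vector_arith bm.y_def bm.u_def block_vector_eq_iff algebra_simps
          minus)
    then show ?thesis by (simp add: bm.field_def diagonal_matrix_mult_inverse CL)
  qed
  have E: "E = {z. bm.field z = 0}"
  proof -
    have "state_rhs H C L M Q \<Phi>0 v0 i0 z = 0 \<longleftrightarrow> bm.field z = 0" for z
      using diagonal_matrix_mult_eq_iff[of C _ 0, OF CL(1)] diagonal_matrix_mult_eq_iff[of L _ 0, OF CL(2)]
      by (simp add: rhs block_vector_arith(4) block_vector_eq_iff prod_eq_iff)
    then show ?thesis by (simp add: E_def equilibria_def)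
  qed
  \<comment> \<open>The diagonal entries of \<open>C\<close> and \<open>L\<close> are nonzero, so
    the block equation determines the velocity.\<close>
  have x: "(x has_vector_derivative bm.field (x t)) (at t within J)" if "t \<in> J" for t
    using solution that diagonal_matrix_mult_eq_iff[of C, OF CL(1)] diagonal_matrix_mult_eq_iff[of L, OF CL(2)]
    unfolding solves_state_equations_def rhs block_vector_eq_iff
    by (metis prod.collapse)
  have J: "{0..t} \<subseteq> J" if "t \<in> J" for t
    using that unfolding J_def by (auto intro: le_less_trans[of "ereal _" "ereal t"])
  have bdd: "bounded (x ` J)"
    by (rule bm.trajectory_bounded[OF _ J x]) (auto simp: J_def)
  have "converges_to_set x E \<and>
      ((\<forall>e\<in>E. e isolated_in E) \<longrightarrow> (\<exists>e\<in>E. (x \<longlongrightarrow> e) at_top))" if "tmax = \<infinity>"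
  proof -
    have "J = {0..}" using that by (auto simp: J_def)
    then have "\<And>t. 0 \<le> t \<Longrightarrow> (x has_vector_derivative bm.field (x t)) (at t within {0..})"
      using x by auto
    from bm.trajectory_convergent[OF this] show ?thesis by (simp add: E)
  qed
  with bdd show ?thesis by blast
qed

end
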